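(* Let $M=(M_t)_{t\in[0,T]}$ be a centered Gaussian martingale with Lipschitz continuous variance function, and let $X=(X_t)_{t\in[0,T]}$ be a Gaussian process that is Hölder continuous of order $\alpha$ for some $\alpha>\frac12$ ($M$ and $X$ are not assumed independent). Put $Y=M+X$, a centered continuous Gaussian process with covariance $R(t,s)=\mathbb{E}[Y_tY_s]$ and variance $V(t)=R(t,t)$, and assume: (a) $R(s,t)>0$ for all $s,t>0$; (b) there exist $c,\delta>0$ such that $V(s)\ge cs^2$ for $s\le\delta$; (c) there exists $\delta>0$ such that $\sup_{0<t<2\delta}\sup_{t/2\le s\le t}\frac{R(s,s)}{R(t,s)}<\infty$; (d) $Y$ is adapted to the filtration $\mathcal{F}^M$ generated by $M$. Let $f:\mathbb{R}\to\mathbb{R}$ be a linear combination of convex functions, with left derivative $f'_-$, and let $\tau\le T$ be a stopping time (with respect to $\mathcal{F}^M$). Then the integral $$\int_0^\tau f'_-(Y_u)\,dY_u=\int_0^\tau f'_-(Y_u)\,dM_u+\int_0^\tau f'_-(Y_u)\,dX_u$$ exists as a Föllmer integral, along a suitable sequence of partitions of $[0,T]$ with mesh tending to $0$.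
   Context: Fix $T>0$. Hölder continuity: a process $X$ on $[0,T]$ is Hölder continuous of order $\alpha$ if there is an almost surely finite random variable $C_T$ with $|X_t-X_s|\le C_T|t-s|^\alpha$ almost surely for all $s,t\in[0,T]$. Föllmer integral: let $(\pi_n)$ be a sequence of partitions $\pi_n=\{0=t_0^n<\dots<t_{k(n)}^n=T\}$ with $|\pi_n|=\max_j|t_j^n-t_{j-1}^n|\to0$. For a continuous process $Z$ and a process $H$, the Föllmer integral of $H$ with respect to $Z$ along $(\pi_n)$ is $$\int_0^t H_u\,dZ_u=\lim_{n\to\infty}\sum_{t_j^n\in\pi_n\cap(0,t]}H_{t_{j-1}^n}\,(Z_{t_j^n}-Z_{t_{j-1}^n}),$$ provided the limit exists almost surely; for a random time $\tau$ one takes $t=\tau$ in the sum. *)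

theory Defs
  imports "HOL-Probability.Probability"
begin

text \<open>Processes are functions \<open>X t \<omega>\<close>; only times in \<open>{0..T}\<close> matter.
  Point masses count as (degenerate) Gaussian random variables.\<close>

definition gaussian_rv :: "'a measure \<Rightarrow> ('a \<Rightarrow> real) \<Rightarrow> bool" where
  "gaussian_rv P Z \<longleftrightarrow> Z \<in> borel_measurable P \<and>
     ((\<exists>m. AE \<omega> in P. Z \<omega> = m) \<or>
      (\<exists>m s. s > 0 \<and> distributed P lborel Z (normal_density m s)))"

definition gaussian_process :: "'a measure \<Rightarrow> real \<Rightarrow> (real \<Rightarrow> 'a \<Rightarrow> real) \<Rightarrow> bool" where
  "gaussian_process P T X \<longleftrightarrow>
     (\<forall>J c. finite J \<longrightarrow> J \<subseteq> {0..T} \<longrightarrow> gaussian_rv P (\<lambda>\<omega>. \<Sum>t\<in>J. c t * X t \<omega>))"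

definition centered_process :: "'a measure \<Rightarrow> real \<Rightarrow> (real \<Rightarrow> 'a \<Rightarrow> real) \<Rightarrow> bool" where
  "centered_process P T X \<longleftrightarrow>
     (\<forall>t\<in>{0..T}. integrable P (X t) \<and> integral\<^sup>L P (X t) = 0)"

definition variance_fun :: "'a measure \<Rightarrow> (real \<Rightarrow> 'a \<Rightarrow> real) \<Rightarrow> real \<Rightarrow> real" where
  "variance_fun P X t = integral\<^sup>L P (\<lambda>\<omega>. (X t \<omega> - integral\<^sup>L P (X t))\<^sup>2)"

definition second_moment_fun ::
    "'a measure \<Rightarrow> (real \<Rightarrow> 'a \<Rightarrow> real) \<Rightarrow> real \<Rightarrow> real \<Rightarrow> real" where
  "second_moment_fun P Y t s = integral\<^sup>L P (\<lambda>\<omega>. Y t \<omega> * Y s \<omega>)"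

text \<open>The filtration generated by \<open>X\<close>, not augmented by null sets.  Since
  \<^const>\<open>stopping_time\<close> quantifies over all times of the index type, it is extended to all real
  \<open>t\<close>: trivial for \<open>t < 0\<close>, constant for \<open>t \<ge> T\<close>.\<close>

definition natural_filtration ::
    "'a measure \<Rightarrow> real \<Rightarrow> (real \<Rightarrow> 'a \<Rightarrow> real) \<Rightarrow> real \<Rightarrow> 'a measure" where
  "natural_filtration P T X t =
     sigma (space P) {X s -` B \<inter> space P | s B. 0 \<le> s \<and> s \<le> t \<and> s \<le> T \<and> B \<in> sets borel}"

definition adapted_process ::
    "(real \<Rightarrow> 'a measure) \<Rightarrow> real \<Rightarrow> (real \<Rightarrow> 'a \<Rightarrow> real) \<Rightarrow> bool" where
  "adapted_process F T X \<longleftrightarrow> (\<forall>t\<in>{0..T}. X t \<in> borel_measurable (F t))"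

definition martingale_process ::
    "'a measure \<Rightarrow> (real \<Rightarrow> 'a measure) \<Rightarrow> real \<Rightarrow> (real \<Rightarrow> 'a \<Rightarrow> real) \<Rightarrow> bool" where
  "martingale_process P F T X \<longleftrightarrow>
     adapted_process F T X \<and>
     (\<forall>t\<in>{0..T}. integrable P (X t)) \<and>
     (\<forall>s t. 0 \<le> s \<longrightarrow> s \<le> t \<longrightarrow> t \<le> T \<longrightarrow>
        (AE \<omega> in P. real_cond_exp P (F s) (X t) \<omega> = X s \<omega>))"

definition continuous_process :: "'a measure \<Rightarrow> real \<Rightarrow> (real \<Rightarrow> 'a \<Rightarrow> real) \<Rightarrow> bool" where
  "continuous_process P T X \<longleftrightarrow> (AE \<omega> in P. continuous_on {0..T} (\<lambda>t. X t \<omega>))"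

definition hoelder_process ::
    "'a measure \<Rightarrow> real \<Rightarrow> real \<Rightarrow> (real \<Rightarrow> 'a \<Rightarrow> real) \<Rightarrow> bool" where
  "hoelder_process P T \<alpha> X \<longleftrightarrow>
     (\<exists>C \<in> borel_measurable P. AE \<omega> in P. \<forall>s\<in>{0..T}. \<forall>t\<in>{0..T}.
        \<bar>X t \<omega> - X s \<omega>\<bar> \<le> C \<omega> * \<bar>t - s\<bar> powr \<alpha>)"

definition lin_comb_convex :: "(real \<Rightarrow> real) \<Rightarrow> bool" where
  "lin_comb_convex f \<longleftrightarrow>
     (\<exists>(n::nat) a g. (\<forall>i<n. convex_on UNIV (g i)) \<and> f = (\<lambda>x. \<Sum>i<n. a i * g i x))"

definition left_deriv :: "(real \<Rightarrow> real) \<Rightarrow> real \<Rightarrow> real" where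
  "left_deriv f x = vector_derivative f (at_left x)"

text \<open>A partition \<open>0 = p 0 < \<dots> < p k = T\<close> is given by \<open>k\<close> and the values \<open>p j\<close> for
  \<open>j \<le> k\<close>.\<close>

definition is_partition :: "real \<Rightarrow> nat \<Rightarrow> (nat \<Rightarrow> real) \<Rightarrow> bool" where
  "is_partition T k p \<longleftrightarrow> p 0 = 0 \<and> p k = T \<and> (\<forall>j<k. p j < p (Suc j))"

definition mesh :: "nat \<Rightarrow> (nat \<Rightarrow> real) \<Rightarrow> real" where
  "mesh k p = Max ((\<lambda>j. p (Suc j) - p j) ` {..<k})"

definition partition_seq :: "real \<Rightarrow> (nat \<Rightarrow> nat) \<Rightarrow> (nat \<Rightarrow> nat \<Rightarrow> real) \<Rightarrow> bool" where
  "partition_seq T k p \<longleftrightarrow>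
     (\<forall>n. is_partition T (k n) (p n)) \<and> (\<lambda>n. mesh (k n) (p n)) \<longlonglongrightarrow> 0"

text \<open>The index is shifted: the summand \<open>j\<close> below belongs to the partition point
  \<open>p (Suc j)\<close> in \<open>{0<..t}\<close>.\<close>

definition foellmer_sum ::
    "nat \<Rightarrow> (nat \<Rightarrow> real) \<Rightarrow> (real \<Rightarrow> real) \<Rightarrow> (real \<Rightarrow> real) \<Rightarrow> real \<Rightarrow> real" where
  "foellmer_sum k p h z t =
     (\<Sum>j | j < k \<and> p (Suc j) \<le> t. h (p j) * (z (p (Suc j)) - z (p j)))"

definition foellmer_integral_exists ::
    "'a measure \<Rightarrow> (nat \<Rightarrow> nat) \<Rightarrow> (nat \<Rightarrow> nat \<Rightarrow> real) \<Rightarrow>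
     (real \<Rightarrow> 'a \<Rightarrow> real) \<Rightarrow> (real \<Rightarrow> 'a \<Rightarrow> real) \<Rightarrow> ('a \<Rightarrow> real) \<Rightarrow> bool" where
  "foellmer_integral_exists P k p H Z \<tau> \<longleftrightarrow>
     (AE \<omega> in P. convergent
        (\<lambda>n. foellmer_sum (k n) (p n) (\<lambda>u. H u \<omega>) (\<lambda>u. Z u \<omega>) (\<tau> \<omega>)))"

definition foellmer_integral ::
    "(nat \<Rightarrow> nat) \<Rightarrow> (nat \<Rightarrow> nat \<Rightarrow> real) \<Rightarrow>
     (real \<Rightarrow> 'a \<Rightarrow> real) \<Rightarrow> (real \<Rightarrow> 'a \<Rightarrow> real) \<Rightarrow> ('a \<Rightarrow> real) \<Rightarrow> 'a \<Rightarrow> real" where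
  "foellmer_integral k p H Z \<tau> \<omega> =
     lim (\<lambda>n. foellmer_sum (k n) (p n) (\<lambda>u. H u \<omega>) (\<lambda>u. Z u \<omega>) (\<tau> \<omega>))"

end

theory Submission
  imports Defs
begin

text \<open>
  The integral exists along the dyadic partitions, because the changes of the sums from one dyadic
  level to the next form an almost surely absolutely convergent series.

  Write \<open>h\<close> for the left derivative of \<open>f\<close>. It is a linear combination of monotone functions, and a
  path of \<open>Y\<close> is bounded, so it suffices to treat a monotone bounded \<open>g\<close> that is constant outside a
  bounded interval. Put \<open>G t = g (Y t)\<close> for \<open>t < \<tau>\<close> and \<open>G t = 0\<close> otherwise; unlike the indicator of
  \<open>t' \<le> \<tau>\<close> for a later time \<open>t'\<close>, this is known at time \<open>t\<close>. The Foellmer sum up to \<open>\<tau>\<close> differs from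
  the sum of \<open>G t (Z t' - Z t)\<close> over all dyadic intervals \<open>[t, t']\<close> of level \<open>n\<close> by at most the one
  summand whose interval contains \<open>\<tau>\<close>, which vanishes in the limit by continuity of \<open>Z\<close>. Passing from
  level \<open>n\<close> to level \<open>n + 1\<close> changes the latter sum by the sum of \<open>(G m - G t) (Z t' - Z m)\<close>, where \<open>m\<close>
  is the midpoint of \<open>[t, t']\<close>. Everything therefore rests on how much \<open>G\<close> varies.

  The key estimate (\<open>dyadic_increment_sum_le\<close>, \<open>stopped_increment_sum_le\<close>) is that for every
  positive \<open>b < 1/2\<close> the expected variation of \<open>G\<close> from left end points to midpoints is
  \<open>O(n 2^((1 - b) n))\<close>. To see this, compare \<open>Y m - Y t\<close> with \<open>\<eta> = 2^(-b n)\<close>. The increment has variance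
  \<open>O(2^(-n))\<close>: the martingale contributes its Lipschitz variance, and the Hoelder property of \<open>X\<close> passes
  to its variance because a Gaussian variable that is small with probability 1/2 has small variance.
  Hence \<open>\<bar>Y m - Y t\<bar> > \<eta>\<close> has a probability that decays faster than any power of \<open>2^(-n)\<close>. Otherwise
  \<open>\<bar>g (Y m) - g (Y t)\<bar> \<le> g (Y t + \<eta>) - g (Y t - \<eta>)\<close>, a function of \<open>Y t\<close> with Lebesgue integral
  \<open>O(\<eta>)\<close>, while the density of \<open>Y t\<close> is at most one over its standard deviation, hence \<open>O(1 / t)\<close> by
  the lower bound on the variance. Summing \<open>\<eta> / t\<close> over the grid gives a harmonic sum, which
  accounts for the factor \<open>n\<close>. Stopping at \<open>\<tau>\<close> adds a single jump.

  For \<open>X\<close> the increments of level \<open>n\<close> are \<open>O(2^(-\<alpha> n))\<close>, and \<open>\<alpha> > 1/2\<close> leaves room to choose \<open>b < 1/2\<close>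
  with \<open>\<alpha> + b > 1\<close>; the refinement increments are then absolutely summable in expectation
  (\<open>AE_convergent_hoelder_sums\<close>). For \<open>M\<close> the summands of a refinement increment are orthogonal, so its
  second moment is a sum of second moments, which the key estimate and the fourth moments of the
  increments of \<open>M\<close> bound by a geometrically decaying sequence, up to a factor \<open>n\<close>
  (\<open>AE_convergent_martingale_sums\<close>). The sums for \<open>Y\<close> are the sums for \<open>M\<close> plus those for \<open>X\<close>.
\<close>

section \<open>Centered Gaussian variables and processes\<close>

text \<open>Point masses count as Gaussian, so every estimate below splits into a degenerate case and a case
  with a density.\<close>

lemma centered_gaussian_cases:
  assumes "prob_space P" "gaussian_rv P Z" "integral\<^sup>L P Z = 0"
  obtains (degenerate) "AE \<omega> in P. Z \<omega> = 0"
    | (density) s where "s > 0" "distributed P lborel Z (normal_density 0 s)"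
proof -
  interpret prob_space P by fact
  have Z[measurable]: "Z \<in> borel_measurable P" using assms(2) by (simp add: gaussian_rv_def)
  consider m where "AE \<omega> in P. Z \<omega> = m"
    | m s where "s > 0" "distributed P lborel Z (normal_density m s)"
    using assms(2) by (auto simp: gaussian_rv_def)
  then show thesis
  proof cases
    case 1
    have "integral\<^sup>L P Z = (\<integral>\<omega>. m \<partial>P)" by (intro integral_cong_AE) (use 1 in auto)
    with 1 assms(3) have "AE \<omega> in P. Z \<omega> = 0" by (simp add: prob_space)
    then show thesis by (rule degenerate)
  next
    case 2
    have "m = 0" using normal_distributed_expectation[OF 2] assms(3) by simp
    with 2 show thesis by (intro density) auto
  qed
qed

lemma centered_gaussian_moment:
  assumes "prob_space P" "gaussian_rv P Z" "integral\<^sup>L P Z = 0"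
  shows "integrable P (\<lambda>\<omega>. Z \<omega> ^ (2 * k))"
    and "(\<integral>\<omega>. Z \<omega> ^ (2 * k) \<partial>P) = fact (2 * k) / (2 ^ k * fact k) * (\<integral>\<omega>. (Z \<omega>)\<^sup>2 \<partial>P) ^ k"
proof -
  interpret prob_space P by fact
  have Z[measurable]: "Z \<in> borel_measurable P" using assms(2) by (simp add: gaussian_rv_def)
  have "integrable P (\<lambda>\<omega>. Z \<omega> ^ (2 * k)) \<and>
    (\<integral>\<omega>. Z \<omega> ^ (2 * k) \<partial>P) = fact (2 * k) / (2 ^ k * fact k) * (\<integral>\<omega>. (Z \<omega>)\<^sup>2 \<partial>P) ^ k"
    using assms
  proof (cases rule: centered_gaussian_cases)
    case degenerate
    have 1: "(\<integral>\<omega>. Z \<omega> ^ (2 * k) \<partial>P) = (\<integral>\<omega>. 0 ^ (2 * k) \<partial>P)" for k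
      by (intro integral_cong_AE) (use degenerate in auto)
    have "integrable P (\<lambda>\<omega>. Z \<omega> ^ (2 * k)) \<longleftrightarrow> integrable P (\<lambda>\<omega>. 0 ^ (2 * k) :: real)"
      by (intro integrable_cong_AE) (use degenerate in auto)
    then show ?thesis using 1[of k] 1[of 1] by (cases "k = 0") (auto simp: prob_space power_0_left)
  next
    case (density s)
    have m: "has_bochner_integral lborel (\<lambda>x. normal_density 0 s x * x ^ (2 * k))
        (fact (2 * k) / ((2 / s\<^sup>2) ^ k * fact k))" for k
      using normal_moment_even[OF density(1), of 0 k] by simp
    have e: "(\<integral>\<omega>. Z \<omega> ^ (2 * k) \<partial>P) = fact (2 * k) / ((2 / s\<^sup>2) ^ k * fact k)" for k
      using distributed_integral[OF density(2), of "\<lambda>x. x ^ (2 * k)"]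
        has_bochner_integral_integral_eq[OF m[of k]] by simp
    have i: "integrable P (\<lambda>\<omega>. Z \<omega> ^ (2 * k))"
      using distributed_integrable[OF density(2), of "\<lambda>x. x ^ (2 * k)"]
        integrable.intros[OF m[of k]] by simp
    have "(\<integral>\<omega>. (Z \<omega>)\<^sup>2 \<partial>P) = s\<^sup>2" using e[of 1] by simp
    then show ?thesis using i e[of k] density(1) by (simp add: power_divide field_simps)
  qed
  then show "integrable P (\<lambda>\<omega>. Z \<omega> ^ (2 * k))"
    and "(\<integral>\<omega>. Z \<omega> ^ (2 * k) \<partial>P) = fact (2 * k) / (2 ^ k * fact k) * (\<integral>\<omega>. (Z \<omega>)\<^sup>2 \<partial>P) ^ k"
    by auto
qed

text \<open>The centered normal density with standard deviation \<open>s\<close> is at most \<open>1 / (s sqrt (2 pi)) \<le> 1 / s\<close>.\<close>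

lemma centered_gaussian_density_bound:
  assumes "prob_space P" "gaussian_rv P Z" "integral\<^sup>L P Z = 0"
    and V: "(\<integral>\<omega>. (Z \<omega>)\<^sup>2 \<partial>P) > 0"
    and g: "integrable lborel g" "\<And>x::real. g x \<ge> 0"
  shows "(\<integral>\<omega>. g (Z \<omega>) \<partial>P) \<le> (\<integral>x. g x \<partial>lborel) / sqrt (\<integral>\<omega>. (Z \<omega>)\<^sup>2 \<partial>P)"
proof -
  interpret prob_space P by fact
  have Z[measurable]: "Z \<in> borel_measurable P" using assms(2) by (simp add: gaussian_rv_def)
  show ?thesis using assms(1-3)
  proof (cases rule: centered_gaussian_cases)
    case degenerate
    have "(\<integral>\<omega>. (Z \<omega>)\<^sup>2 \<partial>P) = (\<integral>\<omega>. 0 \<partial>P)"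
      by (intro integral_cong_AE) (use degenerate in auto)
    with V show ?thesis by simp
  next
    case (density s)
    have s: "s > 0" by fact
    have [measurable]: "g \<in> borel_measurable lborel" using g by auto
    have "(\<integral>\<omega>. (Z \<omega>)\<^sup>2 \<partial>P) = s\<^sup>2"
      using distributed_integral[OF density(2), of "\<lambda>x. x ^ 2"] integral_normal_moment_even[OF s, of 0 1]
      by simp
    then have sq: "sqrt (\<integral>\<omega>. (Z \<omega>)\<^sup>2 \<partial>P) = s" using s by simp
    have b: "normal_density 0 s x \<le> 1 / s" for x
    proof -
      have "1 * s \<le> sqrt (2 * pi * s\<^sup>2)"
      proof -
        have "1 * s\<^sup>2 \<le> 2 * pi * s\<^sup>2" using pi_ge_two by (intro mult_right_mono) auto
        then show ?thesis using s by (intro real_le_rsqrt) simp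
      qed
      then have "1 / sqrt (2 * pi * s\<^sup>2) \<le> 1 / s" using s by (intro divide_left_mono) auto
      moreover have "exp (- (x - 0)\<^sup>2 / (2 * s\<^sup>2)) \<le> 1" by simp
      ultimately have "1 / sqrt (2 * pi * s\<^sup>2) * exp (- (x - 0)\<^sup>2 / (2 * s\<^sup>2)) \<le> 1 / s * 1"
        using s by (intro mult_mono) auto
      then show ?thesis by (simp add: normal_density_def)
    qed
    have "(\<integral>\<omega>. g (Z \<omega>) \<partial>P) = (\<integral>x. normal_density 0 s x * g x \<partial>lborel)"
      using distributed_integral[OF density(2), of g] by simp
    also have "\<dots> \<le> (\<integral>x. 1 / s * g x \<partial>lborel)"
    proof (rule integral_mono)
      show i: "integrable lborel (\<lambda>x. 1 / s * g x)" using g by simp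
      show "integrable lborel (\<lambda>x. normal_density 0 s x * g x)"
        by (rule Bochner_Integration.integrable_bound[OF i])
          (use mult_right_mono[OF b g(2)] g(2) s in \<open>auto simp: abs_mult intro!: AE_I2\<close>)
      show "normal_density 0 s x * g x \<le> 1 / s * g x" for x
        using b g by (intro mult_right_mono) auto
    qed
    also have "\<dots> = (\<integral>x. g x \<partial>lborel) / s" by simp
    finally show ?thesis using sq by simp
  qed
qed

text \<open>By the density bound, a Gaussian variable with standard deviation \<open>s\<close> puts mass at most \<open>2 x / s\<close>
  on \<open>[-x, x]\<close>. Thus a bound that holds with probability 1/2 already controls the variance, which
  turns almost sure regularity of a Gaussian process into regularity in mean square.\<close>

lemma centered_gaussian_small_ball:
  assumes "prob_space P" "gaussian_rv P Z" "integral\<^sup>L P Z = 0"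
    and x: "x \<ge> 0" "measure P {\<omega>\<in>space P. \<bar>Z \<omega>\<bar> \<le> x} \<ge> 1 / 2"
  shows "(\<integral>\<omega>. (Z \<omega>)\<^sup>2 \<partial>P) \<le> 16 * x\<^sup>2"
proof (cases "(\<integral>\<omega>. (Z \<omega>)\<^sup>2 \<partial>P) > 0")
  case True
  interpret prob_space P by fact
  have Z[measurable]: "Z \<in> borel_measurable P" using assms(2) by (simp add: gaussian_rv_def)
  let ?V = "\<integral>\<omega>. (Z \<omega>)\<^sup>2 \<partial>P"
  have "1 / 2 \<le> (\<integral>\<omega>. (indicator :: _ \<Rightarrow> _ \<Rightarrow> real) {\<omega>\<in>space P. \<bar>Z \<omega>\<bar> \<le> x} \<omega> \<partial>P)" using x by simp
  also have "\<dots> = (\<integral>\<omega>. indicator {-x..x} (Z \<omega>) \<partial>P)"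
    by (intro Bochner_Integration.integral_cong) (auto simp: indicator_def)
  also have "\<dots> \<le> (\<integral>y. indicator {-x..x} y \<partial>lborel) / sqrt ?V"
    by (intro centered_gaussian_density_bound assms True integrable_real_indicator)
      (auto simp: emeasure_lborel_Icc_eq)
  also have "\<dots> = 2 * x / sqrt ?V" using x by simp
  finally have "sqrt ?V \<le> 4 * x" using True by (simp add: field_simps)
  then have "(sqrt ?V)\<^sup>2 \<le> (4 * x)\<^sup>2" using True by (intro power_mono) auto
  then show ?thesis using True by (simp add: power_mult_distrib)
qed (use zero_le_power2[of x] in linarith)

text \<open>Markov's inequality for the moment of order \<open>2 k\<close>. The exponent \<open>k\<close> is free so that the tail can be
  made smaller than any prescribed power of \<open>v / \<eta>\<^sup>2\<close>.\<close>

lemma centered_gaussian_tail: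
  assumes "prob_space P" "gaussian_rv P Z" "integral\<^sup>L P Z = 0"
    and "(\<integral>\<omega>. (Z \<omega>)\<^sup>2 \<partial>P) \<le> v" "\<eta> > 0"
  shows "measure P {\<omega>\<in>space P. \<bar>Z \<omega>\<bar> > \<eta>} \<le> fact (2 * k) / (2 ^ k * fact k) * (v / \<eta>\<^sup>2) ^ k"
proof -
  interpret prob_space P by fact
  have Z[measurable]: "Z \<in> borel_measurable P" using assms(2) by (simp add: gaussian_rv_def)
  note m = centered_gaussian_moment[OF assms(1-3), of k]
  have "measure P {\<omega>\<in>space P. \<bar>Z \<omega>\<bar> > \<eta>} \<le> measure P {\<omega>\<in>space P. Z \<omega> ^ (2 * k) \<ge> \<eta> ^ (2 * k)}"
  proof (rule finite_measure_mono)
    show "{\<omega>\<in>space P. \<bar>Z \<omega>\<bar> > \<eta>} \<subseteq> {\<omega>\<in>space P. Z \<omega> ^ (2 * k) \<ge> \<eta> ^ (2 * k)}"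
      using assms(5) by (auto simp flip: power_even_abs[of "2 * k" "Z _"] intro!: power_mono)
  qed auto
  also have "\<dots> \<le> (\<integral>\<omega>. Z \<omega> ^ (2 * k) \<partial>P) / \<eta> ^ (2 * k)"
    by (rule integral_Markov_inequality_measure[where A = "space P"])
      (use m assms(5) in \<open>auto simp: power_mult\<close>)
  also have "\<dots> \<le> fact (2 * k) / (2 ^ k * fact k) * v ^ k / \<eta> ^ (2 * k)"
    unfolding m(2) using assms(4,5)
    by (intro divide_right_mono mult_left_mono power_mono) auto
  finally show ?thesis by (simp add: power_divide power_mult)
qed

lemma gaussian_process_diff:
  assumes "gaussian_process P T X" "s \<in> {0..T}" "t \<in> {0..T}"
  shows "gaussian_rv P (\<lambda>\<omega>. X t \<omega> - X s \<omega>)"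
proof (cases "s = t")
  case True
  have "gaussian_rv P (\<lambda>\<omega>. \<Sum>u\<in>{}. 0 * X u \<omega>)"
    using assms(1)[unfolded gaussian_process_def, rule_format, of "{}"] by simp
  with True show ?thesis by simp
next
  case False
  have "gaussian_rv P (\<lambda>\<omega>. \<Sum>u\<in>{s, t}. (if u = t then 1 else -1) * X u \<omega>)"
    using assms(1)[unfolded gaussian_process_def, rule_format, of "{s, t}"] assms(2,3) by simp
  with False show ?thesis by simp
qed

lemma gaussian_process_rv:
  assumes "gaussian_process P T X" "t \<in> {0..T}"
  shows "gaussian_rv P (X t)"
  using assms(1)[unfolded gaussian_process_def, rule_format, of "{t}" "\<lambda>_. 1"] assms(2) by simp

lemma gaussian_process_measurable:
  assumes "gaussian_process P T X" "t \<in> {0..T}"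
  shows "X t \<in> borel_measurable P"
  using gaussian_process_rv[OF assms] by (simp add: gaussian_rv_def)

lemma centered_process_diff:
  assumes "centered_process P T X" "s \<in> {0..T}" "t \<in> {0..T}"
  shows "(\<integral>\<omega>. X t \<omega> - X s \<omega> \<partial>P) = 0"
  using assms by (simp add: centered_process_def)

text \<open>The random Hoelder constant is below some deterministic \<open>n\<close> with probability at least 1/2, and
  \<open>centered_gaussian_small_ball\<close> then applies with that \<open>n\<close>.\<close>

lemma hoelder_gaussian_increment_variance:
  assumes "prob_space P" and g: "gaussian_process P T X" "centered_process P T X"
    and X: "hoelder_process P T \<alpha> X"
  obtains C where "C \<ge> 0"
    "\<And>s t. s \<in> {0..T} \<Longrightarrow> t \<in> {0..T} \<Longrightarrow> (\<integral>\<omega>. (X t \<omega> - X s \<omega>)\<^sup>2 \<partial>P) \<le> C * \<bar>t - s\<bar> powr (2 * \<alpha>)"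
proof -
  interpret prob_space P by fact
  obtain D where D[measurable]: "D \<in> borel_measurable P"
    and hoelder: "AE \<omega> in P. \<forall>s\<in>{0..T}. \<forall>t\<in>{0..T}. \<bar>X t \<omega> - X s \<omega>\<bar> \<le> D \<omega> * \<bar>t - s\<bar> powr \<alpha>"
    using X by (auto simp: hoelder_process_def)
  (* The Hoelder constant is almost surely finite, so the probability of A n tends to 1. *)
  define A where "A = (\<lambda>n::nat. {\<omega>\<in>space P. D \<omega> \<le> real n})"
  have "(\<lambda>n. measure P (A n)) \<longlonglongrightarrow> measure P (\<Union>n. A n)"
    by (intro finite_Lim_measure_incseq) (auto simp: A_def incseq_def)
  also have "(\<Union>n. A n) = space P" by (auto simp: A_def real_arch_simple)
  finally have "(\<lambda>n. measure P (A n)) \<longlonglongrightarrow> 1" by (simp add: prob_space)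
  then have "eventually (\<lambda>n. measure P (A n) > 1 / 2) sequentially" by (rule order_tendstoD) simp
  then obtain n where n: "measure P (A n) > 1 / 2" by (auto simp: eventually_sequentially)
  show thesis
  proof (rule that[of "16 * (real n)\<^sup>2"])
    fix s t assume st: "s \<in> {0..T}" "t \<in> {0..T}"
    let ?x = "real n * \<bar>t - s\<bar> powr \<alpha>"
    note [measurable] = gaussian_process_measurable[OF g(1) st(1)] gaussian_process_measurable[OF g(1) st(2)]
    have "1 / 2 \<le> measure P (A n)" using n by simp
    also have "\<dots> \<le> measure P {\<omega>\<in>space P. \<bar>X t \<omega> - X s \<omega>\<bar> \<le> ?x}"
    proof (rule finite_measure_mono_AE)
      show "AE \<omega> in P. \<omega> \<in> A n \<longrightarrow> \<omega> \<in> {\<omega>\<in>space P. \<bar>X t \<omega> - X s \<omega>\<bar> \<le> ?x}"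
        using hoelder
      proof eventually_elim
        case (elim \<omega>)
        show ?case
        proof
          assume \<omega>: "\<omega> \<in> A n"
          have "\<bar>X t \<omega> - X s \<omega>\<bar> \<le> D \<omega> * \<bar>t - s\<bar> powr \<alpha>" using elim st by blast
          also have "\<dots> \<le> ?x" using \<omega> by (intro mult_right_mono) (auto simp: A_def)
          finally show "\<omega> \<in> {\<omega>\<in>space P. \<bar>X t \<omega> - X s \<omega>\<bar> \<le> ?x}" using \<omega> by (simp add: A_def)
        qed
      qed
    qed auto
    finally have "(\<integral>\<omega>. (X t \<omega> - X s \<omega>)\<^sup>2 \<partial>P) \<le> 16 * ?x\<^sup>2"
      by (intro centered_gaussian_small_ball prob_space_axioms gaussian_process_diff[OF g(1) st]
        centered_process_diff[OF g(2) st]) auto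
    also have "?x\<^sup>2 = (real n)\<^sup>2 * \<bar>t - s\<bar> powr (2 * \<alpha>)"
      by (simp add: power_mult_distrib power2_eq_square powr_add[symmetric])
    finally show "(\<integral>\<omega>. (X t \<omega> - X s \<omega>)\<^sup>2 \<partial>P) \<le> 16 * (real n)\<^sup>2 * \<bar>t - s\<bar> powr (2 * \<alpha>)" by simp
  qed simp
qed

section \<open>Increments of a monotone function of a Gaussian process\<close>

text \<open>After a translation of both terms, the integral becomes that of \<open>g\<close> against the difference of the
  indicators of two intervals shifted by \<open>2 \<eta>\<close>; this difference lives on two intervals of length
  \<open>2 \<eta>\<close>. For monotone \<open>g\<close> the estimate replaces an integration against its Stieltjes measure.\<close>

lemma integral_shift_difference_le:
  fixes g :: "real \<Rightarrow> real" and A :: real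
  assumes [measurable]: "g \<in> borel_measurable borel"
    and K: "\<And>x. \<bar>g x\<bar> \<le> K" and \<eta>: "\<eta> > 0"
  defines "\<phi> \<equiv> \<lambda>y. (g (y + \<eta>) - g (y - \<eta>)) * indicator {-A..A} y"
  shows "integrable lborel \<phi>" "(\<integral>y. \<phi> y \<partial>lborel) \<le> 4 * K * \<eta>"
proof -
  (* G is the shifted function on the fixed interval; F is the same after translation,
     the fixed function on a shifted interval. *)
  define F where "F = (\<lambda>\<epsilon> x. g x * indicator {-A..A} (x + \<epsilon>))"
  define G where "G = (\<lambda>\<epsilon> y. g (y + \<epsilon>) * indicator {-A..A} y)"
  have K0: "K \<ge> 0" using K[of 0] by linarith
  have F: "integrable lborel (F \<epsilon>)" for \<epsilon>
  proof (rule Bochner_Integration.integrable_bound)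
    show "integrable lborel (\<lambda>x. K * indicator {-A-\<epsilon>..A-\<epsilon>} x)"
      by (intro integrable_mult_right integrable_real_indicator)
        (auto simp: emeasure_lborel_Icc_eq)
    show "AE x in lborel. norm (F \<epsilon> x) \<le> norm (K * indicator {-A-\<epsilon>..A-\<epsilon>} x)"
      using K K0 by (auto simp: F_def abs_mult indicator_def)
  qed (simp add: F_def)
  have FG: "(\<lambda>x. F (-\<epsilon>) (\<epsilon> + 1 * x)) = G \<epsilon>" for \<epsilon>
    by (auto simp: F_def G_def add.commute)
  have Gi: "integrable lborel (G \<epsilon>)" for \<epsilon>
    using lborel_integrable_real_affine[OF F[of "-\<epsilon>"], of 1 \<epsilon>] unfolding FG by simp
  have GI: "integral\<^sup>L lborel (G \<epsilon>) = integral\<^sup>L lborel (F (-\<epsilon>))" for \<epsilon>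
    using lborel_integral_real_affine[of 1 "F (-\<epsilon>)" \<epsilon>] unfolding FG by simp
  have \<phi>: "\<phi> = (\<lambda>y. G \<eta> y - G (-\<eta>) y)"
    by (auto simp: \<phi>_def G_def algebra_simps)
  show "integrable lborel \<phi>" unfolding \<phi> using Gi by (intro Bochner_Integration.integrable_diff)
  have "(\<integral>y. \<phi> y \<partial>lborel) = (\<integral>x. F (-\<eta>) x - F \<eta> x \<partial>lborel)"
    unfolding \<phi> using Gi F GI[of \<eta>] GI[of "-\<eta>"]
    by (simp add: Bochner_Integration.integral_diff)
  also have "\<dots> \<le> (\<integral>x. K * (indicator {-A-\<eta>..-A+\<eta>} x + indicator {A-\<eta>..A+\<eta>} x) \<partial>lborel)"
  proof (rule integral_mono)
    show "integrable lborel (\<lambda>x. F (-\<eta>) x - F \<eta> x)"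
      using F by (intro Bochner_Integration.integrable_diff)
    show "integrable lborel (\<lambda>x. K * (indicator {-A-\<eta>..-A+\<eta>} x + indicator {A-\<eta>..A+\<eta>} x))"
      by (intro integrable_mult_right Bochner_Integration.integrable_add integrable_real_indicator)
        (auto simp: emeasure_lborel_Icc_eq)
    show "F (-\<eta>) x - F \<eta> x \<le> K * (indicator {-A-\<eta>..-A+\<eta>} x + indicator {A-\<eta>..A+\<eta>} x)" for x
      using K[of x] K0 \<eta> by (auto simp: F_def indicator_def abs_le_iff)
  qed
  also have "\<dots> = K * (2 * \<eta> + 2 * \<eta>)"
  proof -
    have "(\<integral>x. indicator {-A-\<eta>..-A+\<eta>} x + indicator {A-\<eta>..A+\<eta>} x \<partial>lborel)
        = (\<integral>x. indicator {-A-\<eta>..-A+\<eta>} x \<partial>lborel) + (\<integral>x. indicator {A-\<eta>..A+\<eta>} x \<partial>lborel :: real)"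
      by (intro Bochner_Integration.integral_add integrable_real_indicator)
        (auto simp: emeasure_lborel_Icc_eq)
    then show ?thesis using \<eta> by simp
  qed
  finally show "(\<integral>y. \<phi> y \<partial>lborel) \<le> 4 * K * \<eta>" by (simp add: algebra_simps)
qed

text \<open>If \<open>\<bar>Z' - Z\<bar> \<le> \<eta>\<close>, then monotonicity places both \<open>g Z\<close> and \<open>g Z'\<close> between \<open>g (Z - \<eta>)\<close> and
  \<open>g (Z + \<eta>)\<close>. The difference of these bounds depends on \<open>Z\<close> alone, so the density of \<open>Z\<close> bounds
  its expectation.\<close>

lemma expectation_mono_increment_le:
  fixes g :: "real \<Rightarrow> real"
  assumes "prob_space P" "gaussian_rv P Z" "integral\<^sup>L P Z = 0"
    and V: "(\<integral>\<omega>. (Z \<omega>)\<^sup>2 \<partial>P) > 0"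
    and [measurable]: "Z' \<in> borel_measurable P"
    and g: "mono g" "\<And>x. \<bar>g x\<bar> \<le> K" "\<And>x. g x = g (max (-N) (min N x))"
    and N: "N \<ge> 0" and \<eta>: "\<eta> > 0"
  shows "(\<integral>\<omega>. \<bar>g (Z' \<omega>) - g (Z \<omega>)\<bar> \<partial>P) \<le>
    4 * K * \<eta> / sqrt (\<integral>\<omega>. (Z \<omega>)\<^sup>2 \<partial>P) + 2 * K * measure P {\<omega>\<in>space P. \<bar>Z' \<omega> - Z \<omega>\<bar> > \<eta>}"
proof -
  interpret prob_space P by fact
  have Z[measurable]: "Z \<in> borel_measurable P" using assms(2) by (simp add: gaussian_rv_def)
  have gm[measurable]: "g \<in> borel_measurable borel" by (rule borel_measurable_mono[OF g(1)])
  define \<phi> where "\<phi> = (\<lambda>y. (g (y + \<eta>) - g (y - \<eta>)) * indicator {-(N+\<eta>)..N+\<eta>} y)"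
  note \<phi> = integral_shift_difference_le[OF gm g(2) \<eta>, of "N + \<eta>", folded \<phi>_def]
  have \<phi>0: "\<phi> y \<ge> 0" for y
    using monoD[OF g(1), of "y - \<eta>" "y + \<eta>"] \<eta> by (simp add: \<phi>_def)
  have K0: "K \<ge> 0" using g(2)[of 0] by linarith
  let ?E = "{\<omega>\<in>space P. \<bar>Z' \<omega> - Z \<omega>\<bar> > \<eta>}"
  have bnd: "\<bar>\<phi> y\<bar> \<le> 2 * K" for y
    using g(2)[of "y + \<eta>"] g(2)[of "y - \<eta>"] K0 by (auto simp: \<phi>_def indicator_def abs_le_iff)
  have [measurable]: "\<phi> \<in> borel_measurable borel" by (simp add: \<phi>_def)
  have i\<phi>: "integrable P (\<lambda>\<omega>. \<phi> (Z \<omega>))"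
    by (rule integrable_const_bound[where B = "2 * K"]) (use bnd in auto)
  have gd: "\<bar>g x - g y\<bar> \<le> 2 * K" for x y
    using g(2)[of x] g(2)[of y] by linarith
  have ig: "integrable P (\<lambda>\<omega>. \<bar>g (Z' \<omega>) - g (Z \<omega>)\<bar>)"
    by (rule integrable_const_bound[where B = "2 * K"])
      (use gd in auto)
  have "(\<integral>\<omega>. \<bar>g (Z' \<omega>) - g (Z \<omega>)\<bar> \<partial>P) \<le> (\<integral>\<omega>. \<phi> (Z \<omega>) + 2 * K * indicator ?E \<omega> \<partial>P)"
  proof (rule integral_mono)
    show "integrable P (\<lambda>\<omega>. \<phi> (Z \<omega>) + 2 * K * indicator ?E \<omega>)"
      by (intro Bochner_Integration.integrable_add i\<phi> integrable_mult_right integrable_real_indicator)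
        (auto simp: less_top[symmetric])
    fix \<omega> assume \<omega>: "\<omega> \<in> space P"
    show "\<bar>g (Z' \<omega>) - g (Z \<omega>)\<bar> \<le> \<phi> (Z \<omega>) + 2 * K * indicator ?E \<omega>"
    proof (cases "\<bar>Z' \<omega> - Z \<omega>\<bar> > \<eta>")
      case True
      have "\<bar>g (Z' \<omega>) - g (Z \<omega>)\<bar> \<le> 2 * K" using g(2)[of "Z' \<omega>"] g(2)[of "Z \<omega>"] by linarith
      with True \<phi>0[of "Z \<omega>"] \<omega> show ?thesis by simp
    next
      case False
      have "g (Z \<omega> - \<eta>) \<le> g (Z' \<omega>)" "g (Z' \<omega>) \<le> g (Z \<omega> + \<eta>)"
        "g (Z \<omega> - \<eta>) \<le> g (Z \<omega>)" "g (Z \<omega>) \<le> g (Z \<omega> + \<eta>)"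
        using False \<eta> by (auto intro!: monoD[OF g(1)])
      then have le: "\<bar>g (Z' \<omega>) - g (Z \<omega>)\<bar> \<le> g (Z \<omega> + \<eta>) - g (Z \<omega> - \<eta>)" by linarith
      have "g (Z \<omega> + \<eta>) - g (Z \<omega> - \<eta>) = \<phi> (Z \<omega>)"
      proof (cases "Z \<omega> \<in> {-(N+\<eta>)..N+\<eta>}")
        case out: False
        (* Outside this interval both arguments lie in the same region where g is constant. *)
        have "max (-N) (min N (Z \<omega> + \<eta>)) = max (-N) (min N (Z \<omega> - \<eta>))"
          using out \<eta> N by (auto simp: max_def min_def)
        then have "g (Z \<omega> + \<eta>) = g (Z \<omega> - \<eta>)"
          using g(3)[of "Z \<omega> + \<eta>"] g(3)[of "Z \<omega> - \<eta>"] by metis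
        with out show ?thesis by (simp add: \<phi>_def)
      qed (simp add: \<phi>_def)
      with le False show ?thesis by simp
    qed
  qed (rule ig)
  also have "\<dots> = (\<integral>\<omega>. \<phi> (Z \<omega>) \<partial>P) + 2 * K * measure P ?E"
    by (subst Bochner_Integration.integral_add) (auto intro!: i\<phi> simp: less_top[symmetric])
  also have "(\<integral>\<omega>. \<phi> (Z \<omega>) \<partial>P) \<le> (\<integral>y. \<phi> y \<partial>lborel) / sqrt (\<integral>\<omega>. (Z \<omega>)\<^sup>2 \<partial>P)"
    by (intro centered_gaussian_density_bound assms(1-3) V \<phi> \<phi>0)
  also have "\<dots> \<le> 4 * K * \<eta> / sqrt (\<integral>\<omega>. (Z \<omega>)\<^sup>2 \<partial>P)"
    by (intro divide_right_mono \<phi>) simp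
  finally show ?thesis by simp
qed

text \<open>Each dyadic block of indices contributes at most 1. The term with \<open>j = 0\<close> is zero, as
  \<open>1 / 0 = 0\<close>.\<close>

lemma harmonic_sum_dyadic_le: "(\<Sum>j<2 ^ n. 1 / real j) \<le> real n"
proof (induction n)
  case (Suc n)
  have "(\<Sum>j<2 ^ Suc n. 1 / real j) = (\<Sum>j<2 ^ n. 1 / real j) + (\<Sum>j\<in>{2 ^ n..<2 ^ Suc n}. 1 / real j)"
    unfolding lessThan_atLeast0
    by (rule sum.atLeastLessThan_concat[symmetric]) (auto intro: power_increasing)
  also have "(\<Sum>j\<in>{2 ^ n..<2 ^ Suc n}. 1 / real j) \<le> (\<Sum>j\<in>{2 ^ n..<2 ^ Suc n :: nat}. 1 / 2 ^ n)"
  proof (intro sum_mono divide_left_mono)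
    fix j :: nat assume "j \<in> {2 ^ n..<2 ^ Suc n}"
    then have j: "2 ^ n \<le> j" by simp
    from of_nat_mono[OF this, where 'a = real] show "(2::real) ^ n \<le> real j" by simp
    have "j > 0" using j by (metis gr0I not_less zero_less_power zero_less_numeral)
    then show "0 < real j * 2 ^ n" by simp
  qed auto
  also have "\<dots> = 1" by simp
  finally show ?case using Suc by simp
qed simp

definition dyadic :: "real \<Rightarrow> nat \<Rightarrow> nat \<Rightarrow> real" where
  "dyadic T n j = real j * T / 2 ^ n"

lemma dyadic_Suc_even: "dyadic T (Suc n) (2 * j) = dyadic T n j"
  by (simp add: dyadic_def)

lemma dyadic_mono: "T \<ge> 0 \<Longrightarrow> i \<le> j \<Longrightarrow> dyadic T n i \<le> dyadic T n j"
  by (simp add: dyadic_def divide_right_mono mult_right_mono)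

lemma dyadic_diff: "dyadic T n (Suc j) - dyadic T n j = T / 2 ^ n"
  by (simp add: dyadic_def field_simps)

lemma dyadic_mem:
  assumes "T \<ge> 0" "j \<le> 2 ^ n" shows "dyadic T n j \<in> {0..T}"
proof -
  have "real j \<le> 2 ^ n" using of_nat_mono[OF assms(2), where 'a = real] by simp
  then have "real j * T \<le> 2 ^ n * T" using assms by (intro mult_right_mono)
  then show ?thesis using assms by (simp add: dyadic_def field_simps)
qed

lemma card_dyadic_cell_le_1:
  assumes "T > 0"
  shows "card {j. j < 2 ^ n \<and> dyadic T n j < x \<and> x \<le> dyadic T n (Suc j)} \<le> 1"
proof -
  have "i = j" if "dyadic T n i < x" "x \<le> dyadic T n (Suc i)" "dyadic T n j < x" "x \<le> dyadic T n (Suc j)" for i j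
  proof (rule ccontr)
    assume "i \<noteq> j"
    then have "Suc i \<le> j \<or> Suc j \<le> i" by arith
    then show False using dyadic_mono[of T "Suc i" j n] dyadic_mono[of T "Suc j" i n] that assms by auto
  qed
  then show ?thesis by (intro card_le_Suc0_iff_eq[THEN iffD2, simplified One_nat_def[symmetric]]) auto
qed

text \<open>The midpoint of the interval with left end \<open>dyadic T n j\<close> is \<open>dyadic T (Suc n) (Suc (2 * j))\<close>.
  The trivial estimate of the sum is \<open>O(2^n)\<close>; the gain \<open>2^(-b n)\<close>, for \<open>b\<close> arbitrarily close to
  1/2, is the size of the increments of \<open>Y\<close>. The lower bound on the variance makes the summand of index
  \<open>j\<close> at most of order \<open>2^((1 - b) n) / j\<close>, and the harmonic sum costs the factor \<open>n\<close>.\<close>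

lemma dyadic_increment_sum_le:
  fixes Y :: "real \<Rightarrow> 'a \<Rightarrow> real" and g :: "real \<Rightarrow> real"
  assumes "prob_space P" and T: "T > 0"
    and Yg: "gaussian_process P T Y" and Yc: "centered_process P T Y"
    and incr: "\<And>s t. s \<in> {0..T} \<Longrightarrow> t \<in> {0..T} \<Longrightarrow> (\<integral>\<omega>. (Y t \<omega> - Y s \<omega>)\<^sup>2 \<partial>P) \<le> C * \<bar>t - s\<bar>"
    and c: "c > 0" "\<And>s. s \<in> {0..T} \<Longrightarrow> (\<integral>\<omega>. (Y s \<omega>)\<^sup>2 \<partial>P) \<ge> c * s\<^sup>2"
    and g: "mono g" "\<And>x. \<bar>g x\<bar> \<le> K" "\<And>x. g x = g (max (-N) (min N x))" and N: "N \<ge> 0"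
    and b: "0 < b" "b < 1 / 2"
  obtains B where "B \<ge> 0"
    "\<And>n. (\<Sum>j<2 ^ n. \<integral>\<omega>. \<bar>g (Y (dyadic T (Suc n) (Suc (2 * j))) \<omega>) - g (Y (dyadic T n j) \<omega>)\<bar> \<partial>P)
      \<le> B * (real (Suc n) * 2 powr ((1 - b) * real n))"
proof -
  interpret prob_space P by fact
  have gm[measurable]: "g \<in> borel_measurable borel" by (rule borel_measurable_mono[OF g(1)])
  have K0: "K \<ge> 0" using g(2)[of 0] by linarith
  have C0: "C \<ge> 0"
  proof -
    have "0 \<le> (\<integral>\<omega>. (Y T \<omega> - Y 0 \<omega>)\<^sup>2 \<partial>P)" by simp
    also have "\<dots> \<le> C * T" using incr[of 0 T] T by simp
    finally show ?thesis using T by (simp add: zero_le_mult_iff)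
  qed
  (* The moment of order 2 k gives the tail bound 2 powr (- k (1 - 2 b) n), which must not
     exceed eta = 2 powr (- b n). *)
  obtain k :: nat where k: "real k * (1 - 2 * b) \<ge> b"
    using reals_Archimedean3[of "1 - 2 * b"] b
    by (metis diff_gt_0_iff_gt less_eq_real_def mult_2 field_sum_of_halves add_strict_mono)
  define m where "m = fact (2 * k) / (2 ^ k * fact k) * (C * T) ^ k"
  have m0: "m \<ge> 0" using C0 T by (simp add: m_def)
  define D where "D = 4 * K / sqrt c + 2 * K * m * T"
  have D0: "D \<ge> 0" using K0 m0 T c by (simp add: D_def)
  define e where "e = (\<lambda>n j. \<integral>\<omega>. \<bar>g (Y (dyadic T (Suc n) (Suc (2 * j))) \<omega>) - g (Y (dyadic T n j) \<omega>)\<bar> \<partial>P)"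
  have e_pos: "e n j \<le> D / T * 2 powr ((1 - b) * real n) * (1 / real j)" if j: "0 < j" "j < 2 ^ n" for n j
  proof -
    define s where "s = dyadic T n j"
    define t where "t = dyadic T (Suc n) (Suc (2 * j))"
    have ts: "t - s = T / 2 ^ Suc n"
      unfolding t_def s_def dyadic_Suc_even[symmetric, of T n j] by (rule dyadic_diff)
    have s: "s \<in> {0..T}" unfolding s_def using T j by (intro dyadic_mem) auto
    have s0: "s > 0" using j T by (simp add: s_def dyadic_def)
    have "Suc (2 * j) \<le> 2 ^ Suc n" using j by simp
    then have t: "t \<in> {0..T}" unfolding t_def using T by (intro dyadic_mem) auto
    define \<eta> where "\<eta> = 2 powr (- b * real n)"
    have p2: "(2::real) ^ n = 2 powr real n" by (simp add: powr_realpow)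
    have \<eta>: "\<eta> > 0" by (simp add: \<eta>_def)
    have Ys: "gaussian_rv P (Y s)" "integral\<^sup>L P (Y s) = 0"
      using gaussian_process_rv[OF Yg s] Yc s by (auto simp: centered_process_def)
    have Ym: "Y t \<in> borel_measurable P" by (rule gaussian_process_measurable[OF Yg t])
    have "0 < c * s\<^sup>2" using c s0 by simp
    also have V: "c * s\<^sup>2 \<le> (\<integral>\<omega>. (Y s \<omega>)\<^sup>2 \<partial>P)" by (rule c(2)[OF s])
    finally have V0: "(\<integral>\<omega>. (Y s \<omega>)\<^sup>2 \<partial>P) > 0" .
    have sV: "sqrt c * s \<le> sqrt (\<integral>\<omega>. (Y s \<omega>)\<^sup>2 \<partial>P)"
      using real_sqrt_le_mono[OF V] s by (simp add: real_sqrt_mult)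
    have tail: "measure P {\<omega>\<in>space P. \<bar>Y t \<omega> - Y s \<omega>\<bar> > \<eta>} \<le> m * \<eta>"
    proof -
      have "C * (T / 2 ^ Suc n) \<le> C * (T / 2 ^ n)"
        using C0 T by (intro mult_left_mono divide_left_mono) auto
      then have inc: "(\<integral>\<omega>. (Y t \<omega> - Y s \<omega>)\<^sup>2 \<partial>P) \<le> C * T / 2 ^ n"
        using incr[OF s t] T unfolding ts by simp
      have "measure P {\<omega>\<in>space P. \<bar>Y t \<omega> - Y s \<omega>\<bar> > \<eta>}
        \<le> fact (2 * k) / (2 ^ k * fact k) * (C * T / 2 ^ n / \<eta>\<^sup>2) ^ k"
        by (intro centered_gaussian_tail prob_space_axioms \<eta> gaussian_process_diff[OF Yg]
          centered_process_diff[OF Yc] s t inc)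
      also have "(C * T / 2 ^ n / \<eta>\<^sup>2) ^ k = (C * T) ^ k * (1 / (2 ^ n * \<eta>\<^sup>2)) ^ k"
        by (simp add: power_divide power_mult_distrib)
      also have "1 / (2 ^ n * \<eta>\<^sup>2) = 2 powr (- (1 - 2 * b) * real n)"
      proof -
        have "2 ^ n * \<eta>\<^sup>2 = 2 powr ((1 - 2 * b) * real n)"
          unfolding \<eta>_def power2_eq_square p2 powr_add[symmetric] by (simp add: algebra_simps)
        then show ?thesis by (simp only: powr_minus_divide mult_minus_left)
      qed
      also have "(2 powr (- (1 - 2 * b) * real n)) ^ k = 2 powr (- (real k * (1 - 2 * b)) * real n)"
        by (simp add: powr_power algebra_simps)
      finally have "measure P {\<omega>\<in>space P. \<bar>Y t \<omega> - Y s \<omega>\<bar> > \<eta>}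
        \<le> m * 2 powr (- (real k * (1 - 2 * b)) * real n)" by (simp add: m_def mult.assoc)
      also have "\<dots> \<le> m * \<eta>" unfolding \<eta>_def
        using k m0 by (intro mult_left_mono powr_mono mult_right_mono) auto
      finally show ?thesis .
    qed
    have "e n j \<le> 4 * K * \<eta> / sqrt (\<integral>\<omega>. (Y s \<omega>)\<^sup>2 \<partial>P)
        + 2 * K * measure P {\<omega>\<in>space P. \<bar>Y t \<omega> - Y s \<omega>\<bar> > \<eta>}"
      unfolding e_def s_def[symmetric] t_def[symmetric]
      by (intro expectation_mono_increment_le[OF prob_space_axioms Ys V0 Ym g N \<eta>])
    also have "\<dots> \<le> 4 * K * \<eta> / (sqrt c * s) + 2 * K * (m * \<eta>)"
    proof (intro add_mono mult_left_mono tail divide_left_mono sV)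
      show "0 < sqrt (\<integral>\<omega>. (Y s \<omega>)\<^sup>2 \<partial>P) * (sqrt c * s)" using V0 c s0 by simp
    qed (use K0 \<eta> in auto)
    (* Since s is at most T, the tail term can be absorbed into the term of order eta / s. *)
    also have "2 * K * (m * \<eta>) \<le> 2 * K * m * T * \<eta> / s"
    proof -
      have "2 * K * m * \<eta> * s \<le> 2 * K * m * \<eta> * T" using s s0 K0 m0 \<eta> by (intro mult_left_mono) auto
      then show ?thesis using s0 by (simp add: field_simps)
    qed
    finally have "e n j \<le> D * \<eta> / s" using s0 c by (simp add: D_def field_simps)
    also have "\<dots> = D / T * (\<eta> * 2 ^ n) * (1 / real j)" using T j by (simp add: s_def dyadic_def field_simps)
    also have "\<eta> * 2 ^ n = 2 powr ((1 - b) * real n)"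
      unfolding \<eta>_def p2 powr_add[symmetric] by (simp add: algebra_simps)
    finally show ?thesis .
  qed
  have e0: "e n j \<le> 2 * K" if j: "j < 2 ^ n" for n j
  proof -
    have "e n j \<le> (\<integral>\<omega>. 2 * K \<partial>P)" unfolding e_def
    proof (rule integral_mono_AE')
      show "AE \<omega> in P. \<bar>g (Y (dyadic T (Suc n) (Suc (2 * j))) \<omega>) - g (Y (dyadic T n j) \<omega>)\<bar> \<le> 2 * K"
      proof (rule AE_I2)
        fix \<omega> show "\<bar>g (Y (dyadic T (Suc n) (Suc (2 * j))) \<omega>) - g (Y (dyadic T n j) \<omega>)\<bar> \<le> 2 * K"
          using g(2)[of "Y (dyadic T (Suc n) (Suc (2 * j))) \<omega>"] g(2)[of "Y (dyadic T n j) \<omega>"] by linarith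
      qed
    qed (use K0 in auto)
    then show ?thesis by (simp add: prob_space)
  qed
  show thesis
  proof (rule that[of "D / T + 2 * K"])
    show "0 \<le> D / T + 2 * K" using D0 K0 T by simp
    fix n
    define w where "w = 2 powr ((1 - b) * real n)"
    have w: "w \<ge> 1" unfolding w_def using b by (intro ge_one_powr_ge_zero) auto
    (* At time 0 the variance may vanish, so the first summand is bounded trivially. *)
    have "(\<Sum>j<2 ^ n. e n j) \<le> (\<Sum>j<2 ^ n. (if j = 0 then 2 * K else 0) + D / T * w * (1 / real j))"
      using e_pos[of _ n, folded w_def] e0[of _ n] by (intro sum_mono) auto
    also have "\<dots> = 2 * K + D / T * w * (\<Sum>j<2 ^ n. 1 / real j)"
      by (simp add: sum.distrib sum_distrib_left)
    also have "\<dots> \<le> 2 * K * (real (Suc n) * w) + D / T * w * real (Suc n)"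
    proof (intro add_mono mult_left_mono)
      have "1 * 1 \<le> real (Suc n) * w" using w by (intro mult_mono) auto
      then show "2 * K \<le> 2 * K * (real (Suc n) * w)" using K0 mult_left_mono[of 1 "real (Suc n) * w" "2 * K"] by simp
      show "(\<Sum>j<2 ^ n. 1 / real j) \<le> real (Suc n)" using harmonic_sum_dyadic_le[of n] by simp
    qed (use D0 T w in auto)
    finally have "(\<Sum>j<2 ^ n. e n j) \<le> (D / T + 2 * K) * (real (Suc n) * w)"
      by (simp only: algebra_simps)
    then show "(\<Sum>j<2 ^ n. \<integral>\<omega>. \<bar>g (Y (dyadic T (Suc n) (Suc (2 * j))) \<omega>) - g (Y (dyadic T n j) \<omega>)\<bar> \<partial>P)
      \<le> (D / T + 2 * K) * (real (Suc n) * 2 powr ((1 - b) * real n))"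
      unfolding e_def w_def .
  qed
qed

text \<open>Away from 0, only positivity of \<open>V\<close> is known. The comparison of \<open>V s\<close> with \<open>V t\<close> is a substitute for
  continuity: by compactness, values of \<open>V\<close> tending to 0 would produce a point with \<open>V \<le> 0\<close>.\<close>

lemma quadratic_lower_bound:
  fixes V :: "real \<Rightarrow> real"
  assumes near: "c > 0" "\<delta> > 0" "\<And>s. s \<in> {0..T} \<Longrightarrow> s \<le> \<delta> \<Longrightarrow> V s \<ge> c * s\<^sup>2"
    and pos: "\<And>s. s \<in> {0<..T} \<Longrightarrow> V s > 0"
    and cmp: "\<And>s t. s \<in> {0..T} \<Longrightarrow> t \<in> {0..T} \<Longrightarrow> V s \<le> 2 * V t + C * \<bar>s - t\<bar>"
  obtains c' where "c' > 0" "\<And>s. s \<in> {0..T} \<Longrightarrow> V s \<ge> c' * s\<^sup>2"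
proof -
  have "\<exists>m>0. \<forall>s\<in>{\<delta>..T}. V s \<ge> m"
  proof (rule ccontr)
    assume "\<not> ?thesis"
    then have "\<exists>s\<in>{\<delta>..T}. V s < inverse (real (Suc n))" for n
      by (metis inverse_positive_iff_positive not_le of_nat_0_less_iff zero_less_Suc)
    then obtain s where s: "\<And>n. s n \<in> {\<delta>..T}" "\<And>n. V (s n) < inverse (real (Suc n))" by metis
    obtain l r where l: "l \<in> {\<delta>..T}" and r: "strict_mono (r :: nat \<Rightarrow> nat)" "(s \<circ> r) \<longlonglongrightarrow> l"
      using compact_Icc[of \<delta> T] s(1) unfolding compact_def by metis
    have "(\<lambda>n. inverse (real (Suc (r n)))) \<longlonglongrightarrow> 0"
      using LIMSEQ_subseq_LIMSEQ[OF LIMSEQ_inverse_real_of_nat r(1)] by (simp add: o_def)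
    moreover have "(\<lambda>n. s (r n)) \<longlonglongrightarrow> l" using r(2) by (simp add: o_def)
    ultimately have "(\<lambda>n. 2 * inverse (real (Suc (r n))) + C * \<bar>l - s (r n)\<bar>) \<longlonglongrightarrow> 2 * 0 + C * \<bar>l - l\<bar>"
      by (intro tendsto_intros)
    moreover have "V l \<le> 2 * inverse (real (Suc (r n))) + C * \<bar>l - s (r n)\<bar>" for n
      using cmp[of l "s (r n)"] s[of "r n"] l near(2) by auto
    ultimately have "V l \<le> 2 * 0 + C * \<bar>l - l\<bar>" by (intro LIMSEQ_le_const) auto
    with pos[of l] l near(2) show False by auto
  qed
  then obtain m where m: "m > 0" "\<And>s. s \<in> {\<delta>..T} \<Longrightarrow> V s \<ge> m" by auto
  define c' where "c' = min c (m / (T\<^sup>2 + 1))"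
  have T1: "T\<^sup>2 + 1 > 0" using zero_le_power2[of T] by linarith
  show thesis
  proof (rule that[of c'])
    show "c' > 0" using near m T1 by (simp add: c'_def)
    fix s assume s: "s \<in> {0..T}"
    show "V s \<ge> c' * s\<^sup>2"
    proof (cases "s \<le> \<delta>")
      case True
      have "c' * s\<^sup>2 \<le> c * s\<^sup>2" by (intro mult_right_mono) (auto simp: c'_def)
      with near(3)[OF s True] show ?thesis by simp
    next
      case False
      have "s\<^sup>2 \<le> T\<^sup>2" using s by (intro power_mono) auto
      then have "c' * s\<^sup>2 \<le> m / (T\<^sup>2 + 1) * (T\<^sup>2 + 1)"
        using m T1 near by (intro mult_mono) (auto simp: c'_def)
      also have "\<dots> = m" using T1 by simp
      also have "m \<le> V s" using m(2)[of s] s False by auto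
      finally show ?thesis .
    qed
  qed
qed

text \<open>Stopping creates one additional jump of size at most \<open>K\<close>, in the only dyadic interval that
  contains \<open>\<tau> \<omega>\<close>, so the bound for the unstopped process survives with a larger constant.\<close>

lemma stopped_increment_sum_le:
  fixes Y :: "real \<Rightarrow> 'a \<Rightarrow> real" and g :: "real \<Rightarrow> real" and \<tau> :: "'a \<Rightarrow> real"
  assumes "prob_space P" and T: "T > 0"
    and Yg: "gaussian_process P T Y" and Yc: "centered_process P T Y"
    and incr: "\<And>s t. s \<in> {0..T} \<Longrightarrow> t \<in> {0..T} \<Longrightarrow> (\<integral>\<omega>. (Y t \<omega> - Y s \<omega>)\<^sup>2 \<partial>P) \<le> C * \<bar>t - s\<bar>"
    and c: "c > 0" "\<And>s. s \<in> {0..T} \<Longrightarrow> (\<integral>\<omega>. (Y s \<omega>)\<^sup>2 \<partial>P) \<ge> c * s\<^sup>2"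
    and g: "mono g" "\<And>x. \<bar>g x\<bar> \<le> K" "\<And>x. g x = g (max (-N) (min N x))" and N: "N \<ge> 0"
    and b: "0 < b" "b < 1 / 2" and \<tau>: "\<tau> \<in> borel_measurable P"
  defines "G \<equiv> \<lambda>t \<omega>. if t < \<tau> \<omega> then g (Y t \<omega>) else 0"
  obtains B where "B \<ge> 0"
    "\<And>n. (\<Sum>j<2 ^ n. \<integral>\<omega>. \<bar>G (dyadic T (Suc n) (Suc (2 * j))) \<omega> - G (dyadic T n j) \<omega>\<bar> \<partial>P)
      \<le> B * (real (Suc n) * 2 powr ((1 - b) * real n))"
proof -
  interpret prob_space P by fact
  have gm[measurable]: "g \<in> borel_measurable borel" by (rule borel_measurable_mono[OF g(1)])
  note [measurable] = \<tau>
  have K0: "K \<ge> 0" using g(2)[of 0] by linarith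
  obtain B where B: "B \<ge> 0"
    "\<And>n. (\<Sum>j<2 ^ n. \<integral>\<omega>. \<bar>g (Y (dyadic T (Suc n) (Suc (2 * j))) \<omega>) - g (Y (dyadic T n j) \<omega>)\<bar> \<partial>P)
      \<le> B * (real (Suc n) * 2 powr ((1 - b) * real n))"
    using dyadic_increment_sum_le[OF prob_space_axioms T Yg Yc incr c g N b] by blast
  show thesis
  proof (rule that[of "B + K"])
    show "B + K \<ge> 0" using B K0 by simp
    fix n
    define s where "s = dyadic T n"
    define t where "t = (\<lambda>j. dyadic T (Suc n) (Suc (2 * j)))"
    have st: "s j < t j" "t j \<le> s (Suc j)" for j
    proof -
      have "0 < T / 2 ^ Suc n" using T by simp
      moreover have "t j - s j = T / 2 ^ Suc n"
        using dyadic_diff[of T "Suc n" "2 * j"] unfolding s_def t_def dyadic_Suc_even .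
      moreover have "s (Suc j) - t j = T / 2 ^ Suc n"
        using dyadic_diff[of T "Suc n" "Suc (2 * j)"] dyadic_Suc_even[of T n "Suc j"]
        by (simp add: s_def t_def)
      ultimately show "s j < t j" "t j \<le> s (Suc j)" by linarith+
    qed
    (* On A j the stopped integrand jumps to 0 between the left end and the midpoint. *)
    define A where "A = (\<lambda>j. {\<omega>\<in>space P. s j < \<tau> \<omega> \<and> \<tau> \<omega> \<le> t j})"
    have Am: "A j \<in> sets P" for j unfolding A_def by measurable
    have Gd: "(\<integral>\<omega>. \<bar>G (t j) \<omega> - G (s j) \<omega>\<bar> \<partial>P)
        \<le> (\<integral>\<omega>. \<bar>g (Y (t j) \<omega>) - g (Y (s j) \<omega>)\<bar> \<partial>P) + K * measure P (A j)" if j: "j < 2 ^ n" for j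
    proof -
      have "s j \<in> {0..T}" "t j \<in> {0..T}" unfolding s_def t_def
        using j T by (auto simp del: atLeastAtMost_iff intro!: dyadic_mem)
      note [measurable] = gaussian_process_measurable[OF Yg this(1)] gaussian_process_measurable[OF Yg this(2)]
      have i: "integrable P (\<lambda>\<omega>. \<bar>g (Y (t j) \<omega>) - g (Y (s j) \<omega>)\<bar>)"
      proof (rule integrable_const_bound[where B = "2 * K"])
        have "\<bar>g x - g y\<bar> \<le> 2 * K" for x y using g(2)[of x] g(2)[of y] by linarith
        then show "AE \<omega> in P. norm \<bar>g (Y (t j) \<omega>) - g (Y (s j) \<omega>)\<bar> \<le> 2 * K" by simp
      qed auto
      have iA: "integrable P (\<lambda>\<omega>. K * indicator (A j) \<omega>)"
        using Am by (intro integrable_mult_right integrable_real_indicator) (auto simp: less_top[symmetric])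
      have "(\<integral>\<omega>. \<bar>G (t j) \<omega> - G (s j) \<omega>\<bar> \<partial>P)
          \<le> (\<integral>\<omega>. \<bar>g (Y (t j) \<omega>) - g (Y (s j) \<omega>)\<bar> + K * indicator (A j) \<omega> \<partial>P)"
      proof (rule integral_mono_AE')
        show "AE \<omega> in P. \<bar>G (t j) \<omega> - G (s j) \<omega>\<bar>
            \<le> \<bar>g (Y (t j) \<omega>) - g (Y (s j) \<omega>)\<bar> + K * indicator (A j) \<omega>"
          using st(1)[of j] g(2) K0 by (intro AE_I2) (auto simp: G_def A_def add_increasing)
        show "AE \<omega> in P. 0 \<le> \<bar>g (Y (t j) \<omega>) - g (Y (s j) \<omega>)\<bar> + K * indicator (A j) \<omega>" using K0 by simp
        show "integrable P (\<lambda>\<omega>. \<bar>g (Y (t j) \<omega>) - g (Y (s j) \<omega>)\<bar> + K * indicator (A j) \<omega>)"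
          using i iA by (rule Bochner_Integration.integrable_add)
      qed
      also have "\<dots> = (\<integral>\<omega>. \<bar>g (Y (t j) \<omega>) - g (Y (s j) \<omega>)\<bar> \<partial>P) + K * measure P (A j)"
        using i iA Am by (simp add: sets.Int_space_eq2)
      finally show ?thesis .
    qed
    have disj: "(\<Sum>j<2 ^ n. measure P (A j)) \<le> 1"
    proof -
      have "(\<Sum>j<2 ^ n. measure P (A j)) = (\<integral>\<omega>. (\<Sum>j<2 ^ n. indicator (A j) \<omega>) \<partial>P)"
        using Am by (subst Bochner_Integration.integral_sum) (auto simp: sets.Int_space_eq2 less_top[symmetric])
      also have "\<dots> \<le> (\<integral>\<omega>. 1 \<partial>P)"
      proof (rule integral_mono_AE')
        have "(\<Sum>j<2 ^ n. indicator (A j) \<omega>) \<le> (1::real)" for \<omega>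
        proof -
          have "(\<Sum>j<2 ^ n. indicator (A j) \<omega> :: real) = real (card {j. j < 2 ^ n \<and> \<omega> \<in> A j})"
            by (simp add: indicator_def sum.If_cases Int_def)
          also have "card {j. j < 2 ^ n \<and> \<omega> \<in> A j}
              \<le> card {j. j < 2 ^ n \<and> dyadic T n j < \<tau> \<omega> \<and> \<tau> \<omega> \<le> dyadic T n (Suc j)}"
            by (rule card_mono) (use st(2) in \<open>auto simp: A_def s_def intro: order_trans\<close>)
          finally show ?thesis using card_dyadic_cell_le_1[OF T, of n "\<tau> \<omega>"] by simp
        qed
        then show "AE \<omega> in P. (\<Sum>j<2 ^ n. indicator (A j) \<omega>) \<le> (1::real)" by simp
      qed auto
      also have "\<dots> = 1" by (simp add: prob_space)
      finally show ?thesis .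
    qed
    define w where "w = real (Suc n) * 2 powr ((1 - b) * real n)"
    have w: "1 \<le> w"
    proof -
      have "1 \<le> 2 powr ((1 - b) * real n)" using b by (intro ge_one_powr_ge_zero) auto
      then have "1 * 1 \<le> real (Suc n) * 2 powr ((1 - b) * real n)" by (intro mult_mono) auto
      then show ?thesis by (simp add: w_def)
    qed
    have "(\<Sum>j<2 ^ n. \<integral>\<omega>. \<bar>G (t j) \<omega> - G (s j) \<omega>\<bar> \<partial>P)
        \<le> (\<Sum>j<2 ^ n. (\<integral>\<omega>. \<bar>g (Y (t j) \<omega>) - g (Y (s j) \<omega>)\<bar> \<partial>P) + K * measure P (A j))"
      using Gd by (intro sum_mono) auto
    also have "\<dots> = (\<Sum>j<2 ^ n. \<integral>\<omega>. \<bar>g (Y (t j) \<omega>) - g (Y (s j) \<omega>)\<bar> \<partial>P) + K * (\<Sum>j<2 ^ n. measure P (A j))"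
      by (simp add: sum.distrib sum_distrib_left)
    also have "\<dots> \<le> B * w + K * w"
      using B(2)[of n, folded w_def] disj w K0
      by (intro add_mono mult_left_mono) (auto simp: s_def t_def)
    finally show "(\<Sum>j<2 ^ n. \<integral>\<omega>. \<bar>G (dyadic T (Suc n) (Suc (2 * j))) \<omega> - G (dyadic T n j) \<omega>\<bar> \<partial>P)
      \<le> (B + K) * (real (Suc n) * 2 powr ((1 - b) * real n))"
      by (simp add: s_def t_def w_def distrib_right)
  qed
qed

section \<open>Dyadic sums and refinement\<close>

definition dyadic_sum :: "real \<Rightarrow> nat \<Rightarrow> (real \<Rightarrow> real) \<Rightarrow> (real \<Rightarrow> real) \<Rightarrow> real" where
  "dyadic_sum T n G z =
     (\<Sum>j<2 ^ n. G (dyadic T n j) * (z (dyadic T n (Suc j)) - z (dyadic T n j)))"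

text \<open>On the left half of an interval the two levels agree, so only the right half contributes.\<close>

lemma dyadic_sum_refine:
  "dyadic_sum T (Suc n) G z - dyadic_sum T n G z =
    (\<Sum>j<2 ^ n. (G (dyadic T (Suc n) (Suc (2 * j))) - G (dyadic T n j)) *
      (z (dyadic T n (Suc j)) - z (dyadic T (Suc n) (Suc (2 * j)))))"
proof -
  have pairs: "(\<Sum>i<2 * m. f i) = (\<Sum>j<m. f (2 * j) + f (Suc (2 * j)))" for f :: "nat \<Rightarrow> real" and m
    by (induction m) auto
  have "dyadic T (Suc n) (Suc (Suc (2 * j))) = dyadic T n (Suc j)" for j
    using dyadic_Suc_even[of T n "Suc j"] by simp
  then show ?thesis
    unfolding dyadic_sum_def power_Suc pairs sum_subtractf[symmetric]
    by (intro sum.cong refl) (simp only: dyadic_Suc_even, simp add: algebra_simps)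
qed

lemma convergent_if_summable_increments:
  fixes S :: "nat \<Rightarrow> real"
  assumes "summable (\<lambda>n. \<bar>S (Suc n) - S n\<bar>)"
  shows "convergent S"
proof -
  have "summable (\<lambda>n. S (Suc n) - S n)" using assms by (rule summable_rabs_cancel)
  then have "convergent (\<lambda>n. S n - S 0)" by (simp add: summable_iff_convergent sum_lessThan_telescope)
  then show ?thesis using convergent_add[OF _ convergent_const[of "S 0"]] by fastforce
qed

text \<open>The Foellmer sum keeps an interval if its right end is at most \<open>\<tau>\<close>, the dyadic sum of the stopped
  integrand if its left end is below \<open>\<tau>\<close>. The only interval on which they can differ is the one
  containing \<open>\<tau>\<close>, where the increment of \<open>z\<close> tends to 0.\<close>

lemma foellmer_sum_dyadic_minus_dyadic_sum:
  fixes z h :: "real \<Rightarrow> real"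
  assumes T: "T > 0" and z: "continuous_on {0..T} z" and h: "\<And>u. \<bar>h u\<bar> \<le> K"
  shows "(\<lambda>n. foellmer_sum (2 ^ n) (dyadic T n) h z \<tau>
      - dyadic_sum T n (\<lambda>u. if u < \<tau> then h u else 0) z) \<longlonglongrightarrow> 0"
proof (rule LIMSEQ_I)
  fix r :: real assume r: "0 < r"
  have K0: "K \<ge> 0" using h[of 0] by linarith
  have "uniformly_continuous_on {0..T} z" using z by (intro compact_uniformly_continuous) auto
  then obtain d where d: "d > 0"
    "\<And>x y. x \<in> {0..T} \<Longrightarrow> y \<in> {0..T} \<Longrightarrow> dist y x < d \<Longrightarrow> dist (z y) (z x) < r / (K + 1)"
    using r K0 unfolding uniformly_continuous_on_def
    by (metis add_nonneg_pos divide_pos_pos zero_less_one)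
  have "(\<lambda>n. T * (1 / 2) ^ n) \<longlonglongrightarrow> T * 0" by (intro tendsto_mult tendsto_const LIMSEQ_power_zero) auto
  then have "eventually (\<lambda>n. T * (1 / 2) ^ n < d) sequentially" using d by (auto dest: order_tendstoD)
  then obtain n0 where n0: "\<And>n. n \<ge> n0 \<Longrightarrow> T / 2 ^ n < d"
    by (auto simp: eventually_sequentially power_divide)
  show "\<exists>no. \<forall>n\<ge>no. norm (foellmer_sum (2 ^ n) (dyadic T n) h z \<tau>
      - dyadic_sum T n (\<lambda>u. if u < \<tau> then h u else 0) z - 0) < r"
  proof (intro exI allI impI)
    fix n assume n: "n \<ge> n0"
    define p where "p = dyadic T n"
    define D where "D = {j. j < 2 ^ n \<and> p j < \<tau> \<and> \<not> p (Suc j) \<le> \<tau>}"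
    have pmono: "p j < p (Suc j)" for j using dyadic_diff[of T n j] T unfolding p_def
      by (metis diff_gt_0_iff_gt divide_pos_pos zero_less_power zero_less_numeral)
    have sp: "{j. j < 2 ^ n \<and> p j < \<tau>} = {j. j < 2 ^ n \<and> p (Suc j) \<le> \<tau>} \<union> D"
      using pmono by (auto simp: D_def intro: less_le_trans)
    have "dyadic_sum T n (\<lambda>u. if u < \<tau> then h u else 0) z
        = (\<Sum>j | j < 2 ^ n \<and> p j < \<tau>. h (p j) * (z (p (Suc j)) - z (p j)))"
      unfolding dyadic_sum_def p_def[symmetric] by (intro sum.mono_neutral_cong_right) auto
    also have "\<dots> = foellmer_sum (2 ^ n) p h z \<tau> + (\<Sum>j\<in>D. h (p j) * (z (p (Suc j)) - z (p j)))"
      unfolding sp foellmer_sum_def by (subst sum.union_disjoint) (auto simp: D_def)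
    finally have "norm (foellmer_sum (2 ^ n) p h z \<tau> - dyadic_sum T n (\<lambda>u. if u < \<tau> then h u else 0) z - 0)
        = \<bar>\<Sum>j\<in>D. h (p j) * (z (p (Suc j)) - z (p j))\<bar>" by simp
    also have "\<dots> \<le> (\<Sum>j\<in>D. \<bar>h (p j) * (z (p (Suc j)) - z (p j))\<bar>)" by (rule sum_abs)
    also have "\<dots> \<le> real (card D) * (K * (r / (K + 1)))"
    proof (rule sum_bounded_above)
      fix j assume j: "j \<in> D"
      have "p j \<in> {0..T}" "p (Suc j) \<in> {0..T}" using j T
        unfolding p_def by (auto simp: D_def simp del: atLeastAtMost_iff intro!: dyadic_mem)
      moreover have "dist (p (Suc j)) (p j) < d"
        using dyadic_diff[of T n j] n0[OF n] T by (simp add: p_def dist_real_def)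
      ultimately have "\<bar>z (p (Suc j)) - z (p j)\<bar> < r / (K + 1)" using d(2) by (simp add: dist_real_def)
      then show "\<bar>h (p j) * (z (p (Suc j)) - z (p j))\<bar> \<le> K * (r / (K + 1))"
        unfolding abs_mult using h K0 by (intro mult_mono) auto
    qed
    also have "\<dots> \<le> 1 * (K * (r / (K + 1)))"
    proof (rule mult_right_mono)
      have "card D \<le> card {j. j < 2 ^ n \<and> dyadic T n j < \<tau> \<and> \<tau> \<le> dyadic T n (Suc j)}"
        by (rule card_mono) (auto simp: D_def p_def)
      with card_dyadic_cell_le_1[OF T, of n \<tau>] show "real (card D) \<le> 1" by linarith
    qed (use K0 r in auto)
    also have "\<dots> < r" using K0 r by (simp add: field_simps)
    finally show "norm (foellmer_sum (2 ^ n) (dyadic T n) h z \<tau>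
      - dyadic_sum T n (\<lambda>u. if u < \<tau> then h u else 0) z - 0) < r" by (simp add: p_def)
  qed
qed

lemma partition_seq_dyadic:
  assumes "T > 0"
  shows "partition_seq T (\<lambda>n. 2 ^ n) (dyadic T)"
proof -
  have "mesh (2 ^ n) (dyadic T n) = T * (1 / 2) ^ n" for n
  proof -
    have "(\<lambda>j. dyadic T n (Suc j) - dyadic T n j) ` {..<2 ^ n} = {T / 2 ^ n}"
      unfolding dyadic_diff by (auto simp: image_constant_conv lessThan_empty_iff)
    then show ?thesis by (simp add: mesh_def power_divide)
  qed
  moreover have "(\<lambda>n. T * (1 / 2) ^ n) \<longlonglongrightarrow> T * 0"
    by (intro tendsto_mult tendsto_const LIMSEQ_power_zero) auto
  moreover have "dyadic T n j < dyadic T n (Suc j)" for n j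
  proof -
    have "0 < T / 2 ^ n" using assms by simp
    then show ?thesis using dyadic_diff[of T n j] by linarith
  qed
  ultimately show ?thesis by (simp add: partition_seq_def is_partition_def) (simp add: dyadic_def)
qed

lemma convergent_foellmer_dyadic:
  assumes T: "T > 0" and z: "continuous_on {0..T} z" and h: "\<And>u. \<bar>h u\<bar> \<le> K"
    and S: "convergent (\<lambda>n. dyadic_sum T n (\<lambda>u. if u < \<tau> then h u else 0) z)"
  shows "convergent (\<lambda>n. foellmer_sum (2 ^ n) (dyadic T n) h z \<tau>)"
proof -
  have "(\<lambda>n. foellmer_sum (2 ^ n) (dyadic T n) h z \<tau>
      - dyadic_sum T n (\<lambda>u. if u < \<tau> then h u else 0) z) \<longlonglongrightarrow> 0"
    using h by (intro foellmer_sum_dyadic_minus_dyadic_sum[OF T z])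
  from convergent_add[OF convergentI[OF this] S] show ?thesis by simp
qed

section \<open>Almost sure convergence of the dyadic sums\<close>

lemma summable_Suc_powr:
  assumes "x > 0"
  shows "summable (\<lambda>n. real (Suc n) * 2 powr (- x * real n))"
proof -
  have "2 powr (- x) < 2 powr (0::real)" using assms by (intro powr_less_mono) auto
  then have "summable (\<lambda>n. real (Suc n) * (2 powr (- x)) ^ n)"
    using geometric_deriv_sums[of "2 powr (- x)"] by (auto simp: sums_iff)
  then show ?thesis by (simp add: powr_power mult.commute[of x])
qed

lemma AE_summable_of_expectations:
  fixes W :: "nat \<Rightarrow> 'a \<Rightarrow> real"
  assumes W: "\<And>n. integrable M (W n)" and e: "\<And>n. (\<integral>\<omega>. \<bar>W n \<omega>\<bar> \<partial>M) \<le> e n" "summable e"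
  shows "AE \<omega> in M. summable (\<lambda>n. \<bar>W n \<omega>\<bar>)"
proof -
  have [measurable]: "W n \<in> borel_measurable M" for n using W by auto
  have e0: "e n \<ge> 0" for n using order_trans[OF _ e(1)] by (simp add: Bochner_Integration.integral_nonneg)
  have "(\<integral>\<^sup>+\<omega>. (\<Sum>n. ennreal \<bar>W n \<omega>\<bar>) \<partial>M) = (\<Sum>n. \<integral>\<^sup>+\<omega>. ennreal \<bar>W n \<omega>\<bar> \<partial>M)"
    by (rule nn_integral_suminf) auto
  also have "\<dots> = (\<Sum>n. ennreal (\<integral>\<omega>. \<bar>W n \<omega>\<bar> \<partial>M))"
    using W by (intro suminf_cong nn_integral_eq_integral) auto
  also have "\<dots> \<le> (\<Sum>n. ennreal (e n))" using e by (intro suminf_le) (auto intro: ennreal_leI)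
  also have "\<dots> = ennreal (\<Sum>n. e n)" using e e0 by (intro suminf_ennreal2) auto
  also have "\<dots> < \<infinity>" by simp
  finally have "AE \<omega> in M. (\<Sum>n. ennreal \<bar>W n \<omega>\<bar>) \<noteq> \<infinity>"
    by (intro nn_integral_PInf_AE) auto
  then show ?thesis
  proof eventually_elim
    case (elim \<omega>)
    then show ?case by (intro summable_suminf_not_top) auto
  qed
qed

lemma continuous_on_hoelder_bound:
  fixes x :: "real \<Rightarrow> real"
  assumes \<alpha>: "\<alpha> > 0"
    and x: "\<And>s t. s \<in> {0..T} \<Longrightarrow> t \<in> {0..T} \<Longrightarrow> \<bar>x t - x s\<bar> \<le> C * \<bar>t - s\<bar> powr \<alpha>"
  shows "continuous_on {0..T} x"
  unfolding continuous_on_def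
proof
  fix s assume s: "s \<in> {0..T}"
  have "((\<lambda>t. C * \<bar>t - s\<bar> powr \<alpha>) \<longlongrightarrow> C * \<bar>s - s\<bar> powr \<alpha>) (at s within {0..T})"
    using \<alpha> by (intro tendsto_intros tendsto_powr2) auto
  then have "((\<lambda>t. C * \<bar>t - s\<bar> powr \<alpha>) \<longlongrightarrow> 0) (at s within {0..T})" using \<alpha> by simp
  moreover have "eventually (\<lambda>t. norm (x t - x s) \<le> C * \<bar>t - s\<bar> powr \<alpha>) (at s within {0..T})"
    unfolding eventually_at_topological using x[OF s] by auto
  ultimately have "((\<lambda>t. x t - x s) \<longlongrightarrow> 0) (at s within {0..T})" by (rule Lim_null_comparison[rotated])
  then show "(x \<longlongrightarrow> x s) (at s within {0..T})" by (simp add: LIM_zero_iff)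
qed

text \<open>The refinement increment of level \<open>n\<close> is at most the random Hoelder constant times \<open>W n\<close>, where \<open>W n\<close>
  has expectation \<open>O(n 2^((1 - b - \<alpha>) n))\<close>. The constant is split off before expectations are taken,
  because it is only known to be finite.\<close>

lemma AE_convergent_hoelder_sums:
  fixes G X :: "real \<Rightarrow> 'a \<Rightarrow> real"
  assumes "prob_space P" and T: "T > 0" and X: "hoelder_process P T \<alpha> X" and \<alpha>: "\<alpha> > 1 - b"
    and G: "\<And>t. t \<in> {0..T} \<Longrightarrow> G t \<in> borel_measurable P" "\<And>t \<omega>. \<bar>G t \<omega>\<bar> \<le> K"
    and B: "\<And>n. (\<Sum>j<2 ^ n. \<integral>\<omega>. \<bar>G (dyadic T (Suc n) (Suc (2 * j))) \<omega> - G (dyadic T n j) \<omega>\<bar> \<partial>P)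
      \<le> B * (real (Suc n) * 2 powr ((1 - b) * real n))"
  shows "AE \<omega> in P. convergent (\<lambda>n. dyadic_sum T n (\<lambda>u. G u \<omega>) (\<lambda>u. X u \<omega>))"
proof -
  interpret prob_space P by fact
  define H where "H = (\<lambda>n j \<omega>. G (dyadic T (Suc n) (Suc (2 * j))) \<omega> - G (dyadic T n j) \<omega>)"
  define W where "W = (\<lambda>n \<omega>. (T / 2 ^ Suc n) powr \<alpha> * (\<Sum>j<2 ^ n. \<bar>H n j \<omega>\<bar>))"
  have Hi: "integrable P (\<lambda>\<omega>. \<bar>H n j \<omega>\<bar>)" if "j < 2 ^ n" for n j
  proof (rule integrable_const_bound[where B = "2 * K"])
    have "\<bar>H n j \<omega>\<bar> \<le> 2 * K" for \<omega>
      unfolding H_def using G(2)[of "dyadic T (Suc n) (Suc (2 * j))" \<omega>] G(2)[of "dyadic T n j" \<omega>] by linarith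
    then show "AE \<omega> in P. norm \<bar>H n j \<omega>\<bar> \<le> 2 * K" by simp
    have "dyadic T (Suc n) (Suc (2 * j)) \<in> {0..T}" "dyadic T n j \<in> {0..T}"
      using T that by (auto simp del: atLeastAtMost_iff intro!: dyadic_mem)
    then show "(\<lambda>\<omega>. \<bar>H n j \<omega>\<bar>) \<in> borel_measurable P" unfolding H_def
      using G(1) by (intro borel_measurable_abs borel_measurable_diff) auto
  qed
  have W0: "W n \<omega> \<ge> 0" for n \<omega> unfolding W_def by (intro mult_nonneg_nonneg sum_nonneg) auto
  have "AE \<omega> in P. summable (\<lambda>n. \<bar>W n \<omega>\<bar>)"
  proof (rule AE_summable_of_expectations)
    show "integrable P (W n)" for n
      unfolding W_def using Hi by (intro integrable_mult_right Bochner_Integration.integrable_sum) auto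
    show "summable (\<lambda>n. (T / 2) powr \<alpha> * B * (real (Suc n) * 2 powr (- (\<alpha> - (1 - b)) * real n)))"
      using summable_Suc_powr[of "\<alpha> - (1 - b)"] \<alpha> by (intro summable_mult) auto
    fix n
    have "(\<integral>\<omega>. \<bar>W n \<omega>\<bar> \<partial>P) = (T / 2 ^ Suc n) powr \<alpha> * (\<Sum>j<2 ^ n. \<integral>\<omega>. \<bar>H n j \<omega>\<bar> \<partial>P)"
      using Hi by (simp only: abs_of_nonneg[OF W0]) (simp add: W_def Bochner_Integration.integral_sum)
    also have "\<dots> \<le> (T / 2 ^ Suc n) powr \<alpha> * (B * (real (Suc n) * 2 powr ((1 - b) * real n)))"
      using B[of n] unfolding H_def by (intro mult_left_mono) auto
    also have "(T / 2 ^ Suc n) powr \<alpha> = (T / 2) powr \<alpha> * 2 powr (- \<alpha> * real n)"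
    proof -
      have "T / 2 ^ Suc n = T / 2 * 2 powr (- real n)"
        by (simp add: powr_minus_divide powr_realpow)
      then have "(T / 2 ^ Suc n) powr \<alpha> = (T / 2) powr \<alpha> * (2 powr (- real n)) powr \<alpha>"
        using T by (simp only: powr_mult)
      then show ?thesis by (simp add: powr_powr mult.commute)
    qed
    also have "(T / 2) powr \<alpha> * 2 powr (- \<alpha> * real n) * (B * (real (Suc n) * 2 powr ((1 - b) * real n)))
        = (T / 2) powr \<alpha> * B * (real (Suc n) * (2 powr (- \<alpha> * real n) * 2 powr ((1 - b) * real n)))"
      by simp
    also have "2 powr (- \<alpha> * real n) * 2 powr ((1 - b) * real n) = 2 powr (- (\<alpha> - (1 - b)) * real n)"
      unfolding powr_add[symmetric] by (simp add: algebra_simps)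
    finally show "(\<integral>\<omega>. \<bar>W n \<omega>\<bar> \<partial>P)
        \<le> (T / 2) powr \<alpha> * B * (real (Suc n) * 2 powr (- (\<alpha> - (1 - b)) * real n))" .
  qed
  moreover obtain C where C: "AE \<omega> in P. \<forall>s\<in>{0..T}. \<forall>t\<in>{0..T}. \<bar>X t \<omega> - X s \<omega>\<bar> \<le> C \<omega> * \<bar>t - s\<bar> powr \<alpha>"
    using X by (auto simp: hoelder_process_def)
  ultimately show ?thesis
  proof eventually_elim
    case (elim \<omega>)
    have "summable (\<lambda>n. C \<omega> * W n \<omega>)" using elim(1) by (intro summable_mult) (simp add: abs_of_nonneg[OF W0])
    then have "summable (\<lambda>n. \<bar>dyadic_sum T (Suc n) (\<lambda>u. G u \<omega>) (\<lambda>u. X u \<omega>)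
        - dyadic_sum T n (\<lambda>u. G u \<omega>) (\<lambda>u. X u \<omega>)\<bar>)"
    proof (rule summable_comparison_test'[where N = 0])
      fix n :: nat
      have "\<bar>dyadic_sum T (Suc n) (\<lambda>u. G u \<omega>) (\<lambda>u. X u \<omega>) - dyadic_sum T n (\<lambda>u. G u \<omega>) (\<lambda>u. X u \<omega>)\<bar>
          \<le> (\<Sum>j<2 ^ n. \<bar>H n j \<omega> * (X (dyadic T n (Suc j)) \<omega> - X (dyadic T (Suc n) (Suc (2 * j))) \<omega>)\<bar>)"
        unfolding dyadic_sum_refine H_def by (rule sum_abs)
      also have "\<dots> \<le> (\<Sum>j<2 ^ n. \<bar>H n j \<omega>\<bar> * (C \<omega> * (T / 2 ^ Suc n) powr \<alpha>))"
      proof (rule sum_mono)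
        fix j assume "j \<in> {..<(2::nat) ^ n}"
        then have "dyadic T (Suc n) (Suc (2 * j)) \<in> {0..T}" "dyadic T n (Suc j) \<in> {0..T}"
          using T by (auto simp del: atLeastAtMost_iff intro!: dyadic_mem)
        then have "\<bar>X (dyadic T n (Suc j)) \<omega> - X (dyadic T (Suc n) (Suc (2 * j))) \<omega>\<bar>
            \<le> C \<omega> * \<bar>dyadic T n (Suc j) - dyadic T (Suc n) (Suc (2 * j))\<bar> powr \<alpha>"
          using elim(2) by blast
        also have "dyadic T n (Suc j) - dyadic T (Suc n) (Suc (2 * j)) = T / 2 ^ Suc n"
          using dyadic_diff[of T "Suc n" "Suc (2 * j)"] dyadic_Suc_even[of T n "Suc j"] by simp
        finally show "\<bar>H n j \<omega> * (X (dyadic T n (Suc j)) \<omega> - X (dyadic T (Suc n) (Suc (2 * j))) \<omega>)\<bar>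
            \<le> \<bar>H n j \<omega>\<bar> * (C \<omega> * (T / 2 ^ Suc n) powr \<alpha>)"
          using T unfolding abs_mult by (intro mult_left_mono) auto
      qed
      also have "\<dots> = C \<omega> * W n \<omega>" unfolding W_def sum_distrib_right[symmetric] by simp
      finally show "norm \<bar>dyadic_sum T (Suc n) (\<lambda>u. G u \<omega>) (\<lambda>u. X u \<omega>)
          - dyadic_sum T n (\<lambda>u. G u \<omega>) (\<lambda>u. X u \<omega>)\<bar> \<le> C \<omega> * W n \<omega>" by simp
    qed
    then show ?case by (rule convergent_if_summable_increments)
  qed
qed

lemma integrable_product_of_squares:
  fixes U W :: "'a \<Rightarrow> real"
  assumes [measurable]: "U \<in> borel_measurable P" "W \<in> borel_measurable P"
    and "integrable P (\<lambda>\<omega>. (U \<omega>)\<^sup>2)" "integrable P (\<lambda>\<omega>. (W \<omega>)\<^sup>2)"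
  shows "integrable P (\<lambda>\<omega>. U \<omega> * W \<omega>)"
proof (rule Bochner_Integration.integrable_bound)
  show "integrable P (\<lambda>\<omega>. (U \<omega>)\<^sup>2 + (W \<omega>)\<^sup>2)" using assms by auto
  have "\<bar>u * w\<bar> \<le> \<bar>u\<^sup>2 + w\<^sup>2\<bar>" for u w :: real
  proof -
    have "0 \<le> \<bar>u\<bar> * \<bar>w\<bar>" by simp
    moreover have "2 * (\<bar>u\<bar> * \<bar>w\<bar>) \<le> u\<^sup>2 + w\<^sup>2"
      using sum_squares_bound[of "\<bar>u\<bar>" "\<bar>w\<bar>"] by (simp add: mult.assoc)
    ultimately show ?thesis unfolding abs_mult by linarith
  qed
  then show "AE \<omega> in P. norm (U \<omega> * W \<omega>) \<le> norm ((U \<omega>)\<^sup>2 + (W \<omega>)\<^sup>2)" by simp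
qed auto

text \<open>Being Gaussian, the increments of \<open>M\<close> have fourth moments that are controlled by their variances.\<close>

locale gaussian_martingale = prob_space P for P :: "'a measure" +
  fixes F :: "real \<Rightarrow> 'a measure" and T :: real and M :: "real \<Rightarrow> 'a \<Rightarrow> real"
  assumes subalg: "subalgebra P (F t)"
    and filtr: "s \<le> t \<Longrightarrow> subalgebra (F t) (F s)"
    and martingale: "martingale_process P F T M"
    and gaussian: "gaussian_process P T M"
    and centered: "centered_process P T M"
begin

lemma measurable_F: "t \<in> {0..T} \<Longrightarrow> M t \<in> borel_measurable (F t)"
  using martingale by (simp add: martingale_process_def adapted_process_def)

lemma measurable_F_le: "t \<in> {0..T} \<Longrightarrow> t \<le> u \<Longrightarrow> M t \<in> borel_measurable (F u)"
  using measurable_from_subalg[OF filtr measurable_F] .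

lemma measurable_P: "t \<in> {0..T} \<Longrightarrow> M t \<in> borel_measurable P"
  using measurable_from_subalg[OF subalg measurable_F] .

lemma square_integrable: "t \<in> {0..T} \<Longrightarrow> integrable P (\<lambda>\<omega>. (M t \<omega>)\<^sup>2)"
  using centered_gaussian_moment(1)[OF prob_space_axioms gaussian_process_rv[OF gaussian], of t 1] centered
  by (simp add: centered_process_def)

text \<open>The form of the martingale property that is used: square integrability of \<open>U\<close> makes the product
  integrable, and \<open>U\<close> can be taken out of the conditional expectation.\<close>

lemma increment_orthogonal:
  assumes st: "s \<in> {0..T}" "t \<in> {0..T}" "s \<le> t"
    and U: "U \<in> borel_measurable (F s)" "integrable P (\<lambda>\<omega>. (U \<omega>)\<^sup>2)"
  shows "(\<integral>\<omega>. U \<omega> * (M t \<omega> - M s \<omega>) \<partial>P) = 0"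
proof -
  interpret S: finite_measure_subalgebra P "F s" by unfold_locales (rule subalg)
  note [measurable] = measurable_P[OF st(1)] measurable_P[OF st(2)] U(1)
    measurable_from_subalg[OF subalg U(1)]
  have i: "integrable P (\<lambda>\<omega>. U \<omega> * M t \<omega>)" "integrable P (\<lambda>\<omega>. U \<omega> * M s \<omega>)"
    using st U by (auto intro!: integrable_product_of_squares square_integrable)
  have "(\<integral>\<omega>. U \<omega> * M t \<omega> \<partial>P) = (\<integral>\<omega>. U \<omega> * real_cond_exp P (F s) (M t) \<omega> \<partial>P)"
    by (rule S.real_cond_exp_intg(2)[OF i(1), symmetric]) auto
  also have "\<dots> = (\<integral>\<omega>. U \<omega> * M s \<omega> \<partial>P)"
  proof (rule integral_cong_AE)
    have "AE \<omega> in P. real_cond_exp P (F s) (M t) \<omega> = M s \<omega>"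
      using martingale st by (simp add: martingale_process_def)
    then show "AE \<omega> in P. U \<omega> * real_cond_exp P (F s) (M t) \<omega> = U \<omega> * M s \<omega>" by auto
  qed auto
  finally show ?thesis using i by (simp add: right_diff_distrib)
qed

lemma increment_variance:
  assumes st: "s \<in> {0..T}" "t \<in> {0..T}" "s \<le> t"
  shows "(\<integral>\<omega>. (M t \<omega> - M s \<omega>)\<^sup>2 \<partial>P) = variance_fun P M t - variance_fun P M s"
proof -
  have v: "variance_fun P M u = (\<integral>\<omega>. (M u \<omega>)\<^sup>2 \<partial>P)" if "u \<in> {0..T}" for u
    using centered that by (simp add: variance_fun_def centered_process_def)
  have i: "integrable P (\<lambda>\<omega>. M s \<omega> * (M t \<omega> - M s \<omega>))"
    using integrable_product_of_squares[OF measurable_P measurable_P square_integrable square_integrable] st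
      square_integrable[OF st(1)]
    by (simp add: right_diff_distrib power2_eq_square)
  have o: "(\<integral>\<omega>. M s \<omega> * (M t \<omega> - M s \<omega>) \<partial>P) = 0"
    by (intro increment_orthogonal st measurable_F square_integrable)
  have "(\<lambda>\<omega>. (M t \<omega> - M s \<omega>)\<^sup>2) =
      (\<lambda>\<omega>. (M t \<omega>)\<^sup>2 - (M s \<omega>)\<^sup>2 - 2 * (M s \<omega> * (M t \<omega> - M s \<omega>)))"
    by (auto simp: power2_eq_square algebra_simps)
  then have "(\<integral>\<omega>. (M t \<omega> - M s \<omega>)\<^sup>2 \<partial>P)
      = (\<integral>\<omega>. (M t \<omega>)\<^sup>2 - (M s \<omega>)\<^sup>2 - 2 * (M s \<omega> * (M t \<omega> - M s \<omega>)) \<partial>P)" by simp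
  also have "\<dots> = (\<integral>\<omega>. (M t \<omega>)\<^sup>2 \<partial>P) - (\<integral>\<omega>. (M s \<omega>)\<^sup>2 \<partial>P)"
    using square_integrable[OF st(1)] square_integrable[OF st(2)] i o by simp
  finally show ?thesis using v st by simp
qed

lemma increment_square_integrable:
  assumes "s \<in> {0..T}" "t \<in> {0..T}"
  shows "integrable P (\<lambda>\<omega>. (M t \<omega> - M s \<omega>)\<^sup>2)"
  using centered_gaussian_moment(1)[OF prob_space_axioms gaussian_process_diff[OF gaussian]
      centered_process_diff[OF centered], of s t 1] assms by simp

text \<open>Each summand is orthogonal to the sum of the previous ones, which is measurable at the time where
  the new increment starts.\<close>

lemma martingale_transform_L2:
  fixes m :: nat
  assumes ab: "\<And>j. j < m \<Longrightarrow> a j \<in> {0..T}" "\<And>j. j < m \<Longrightarrow> b j \<in> {0..T}" "\<And>j. j < m \<Longrightarrow> a j \<le> b j"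
      "\<And>i j. i < j \<Longrightarrow> j < m \<Longrightarrow> b i \<le> a j"
    and H: "\<And>j. j < m \<Longrightarrow> H j \<in> borel_measurable (F (a j))" "\<And>j \<omega>. j < m \<Longrightarrow> \<bar>H j \<omega>\<bar> \<le> K"
  shows "integrable P (\<lambda>\<omega>. (\<Sum>j<m. H j \<omega> * (M (b j) \<omega> - M (a j) \<omega>))\<^sup>2)"
    "(\<integral>\<omega>. (\<Sum>j<m. H j \<omega> * (M (b j) \<omega> - M (a j) \<omega>))\<^sup>2 \<partial>P)
      = (\<Sum>j<m. \<integral>\<omega>. (H j \<omega>)\<^sup>2 * (M (b j) \<omega> - M (a j) \<omega>)\<^sup>2 \<partial>P)"
proof -
  have "integrable P (\<lambda>\<omega>. (\<Sum>j<m. H j \<omega> * (M (b j) \<omega> - M (a j) \<omega>))\<^sup>2) \<and>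
    (\<integral>\<omega>. (\<Sum>j<m. H j \<omega> * (M (b j) \<omega> - M (a j) \<omega>))\<^sup>2 \<partial>P)
      = (\<Sum>j<m. \<integral>\<omega>. (H j \<omega>)\<^sup>2 * (M (b j) \<omega> - M (a j) \<omega>)\<^sup>2 \<partial>P)"
    using ab H
  proof (induction m)
    case 0 then show ?case by simp
  next
    case (Suc m)
    define S where "S = (\<lambda>\<omega>. \<Sum>j<m. H j \<omega> * (M (b j) \<omega> - M (a j) \<omega>))"
    define I where "I = (\<lambda>\<omega>. M (b m) \<omega> - M (a m) \<omega>)"
    have IH: "integrable P (\<lambda>\<omega>. (S \<omega>)\<^sup>2)"
      "(\<integral>\<omega>. (S \<omega>)\<^sup>2 \<partial>P) = (\<Sum>j<m. \<integral>\<omega>. (H j \<omega>)\<^sup>2 * (M (b j) \<omega> - M (a j) \<omega>)\<^sup>2 \<partial>P)"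
      unfolding S_def using Suc.IH Suc.prems by simp_all
    have SF: "S \<in> borel_measurable (F (a m))" unfolding S_def
    proof (intro borel_measurable_sum borel_measurable_times borel_measurable_diff)
      fix j assume "j \<in> {..<m}"
      then have j: "j < m" by simp
      have le: "a j \<le> a m" "b j \<le> a m" using Suc.prems(3)[of j] Suc.prems(4)[of j m] j by auto
      show "H j \<in> borel_measurable (F (a m))"
        using measurable_from_subalg[OF filtr[OF le(1)]] Suc.prems(5)[of j] j by simp
      show "M (b j) \<in> borel_measurable (F (a m))" "M (a j) \<in> borel_measurable (F (a m))"
        using Suc.prems(1,2)[of j] j le by (auto intro!: measurable_F_le)
    qed
    have HF: "H m \<in> borel_measurable (F (a m))" using Suc.prems by simp
    note [measurable] = measurable_from_subalg[OF subalg SF] measurable_from_subalg[OF subalg HF]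
    have Im[measurable]: "I \<in> borel_measurable P" unfolding I_def
      using Suc.prems(1,2)[of m] by (intro borel_measurable_diff measurable_P) auto
    have I2: "integrable P (\<lambda>\<omega>. (I \<omega>)\<^sup>2)"
      unfolding I_def using Suc.prems(1,2)[of m] by (intro increment_square_integrable) auto
    have Hb: "\<bar>H m \<omega>\<bar> \<le> K" for \<omega> using Suc.prems by simp
    have Hb2: "(H m \<omega>)\<^sup>2 \<le> K\<^sup>2" for \<omega> using power_mono[OF Hb[of \<omega>] abs_ge_zero, where n = 2] by simp
    have HI2: "integrable P (\<lambda>\<omega>. (H m \<omega>)\<^sup>2 * (I \<omega>)\<^sup>2)"
    proof (rule Bochner_Integration.integrable_bound)
      show "integrable P (\<lambda>\<omega>. K\<^sup>2 * (I \<omega>)\<^sup>2)" using I2 by simp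
    qed (use Hb2 in \<open>auto simp: abs_mult intro!: mult_right_mono\<close>)
    have SH2: "integrable P (\<lambda>\<omega>. (S \<omega> * H m \<omega>)\<^sup>2)"
    proof (rule Bochner_Integration.integrable_bound)
      show "integrable P (\<lambda>\<omega>. (S \<omega>)\<^sup>2 * K\<^sup>2)" using IH by simp
    qed (use Hb2 in \<open>auto simp: abs_mult power_mult_distrib intro!: mult_left_mono\<close>)
    have SHI: "integrable P (\<lambda>\<omega>. S \<omega> * H m \<omega> * I \<omega>)"
      by (rule integrable_product_of_squares) (use SH2 I2 in auto)
    have o: "(\<integral>\<omega>. S \<omega> * H m \<omega> * I \<omega> \<partial>P) = 0" unfolding I_def
      using Suc.prems(1-3)[of m] SH2 SF HF by (intro increment_orthogonal) auto
    have e: "(\<lambda>\<omega>. (\<Sum>j<Suc m. H j \<omega> * (M (b j) \<omega> - M (a j) \<omega>))\<^sup>2)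
        = (\<lambda>\<omega>. (S \<omega>)\<^sup>2 + (H m \<omega>)\<^sup>2 * (I \<omega>)\<^sup>2 + 2 * (S \<omega> * H m \<omega> * I \<omega>))"
      by (auto simp: S_def I_def power2_eq_square algebra_simps)
    show ?case unfolding e using IH HI2 SHI o by (simp add: I_def)
  qed
  then show "integrable P (\<lambda>\<omega>. (\<Sum>j<m. H j \<omega> * (M (b j) \<omega> - M (a j) \<omega>))\<^sup>2)"
    "(\<integral>\<omega>. (\<Sum>j<m. H j \<omega> * (M (b j) \<omega> - M (a j) \<omega>))\<^sup>2 \<partial>P)
      = (\<Sum>j<m. \<integral>\<omega>. (H j \<omega>)\<^sup>2 * (M (b j) \<omega> - M (a j) \<omega>)\<^sup>2 \<partial>P)" by auto
qed

text \<open>Bound \<open>H\<^sup>2 I\<^sup>2\<close> by \<open>(l H^4 + I^4 / l) / 2\<close>, where \<open>I\<close> is the increment of \<open>M\<close>, and then \<open>H^4\<close> by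
  \<open>K\<^sup>3 \<bar>H\<bar>\<close>. This decouples integrand and increment and leaves only the first
  moment of \<open>H\<close>, the quantity controlled by the key estimate. The weight \<open>l\<close> is free so that the two
  terms can be balanced.\<close>

lemma martingale_transform_L2_le:
  assumes ab: "\<And>j. j < m \<Longrightarrow> a j \<in> {0..T}" "\<And>j. j < m \<Longrightarrow> b j \<in> {0..T}" "\<And>j. j < m \<Longrightarrow> a j \<le> b j"
      "\<And>i j. i < j \<Longrightarrow> j < m \<Longrightarrow> b i \<le> a j"
    and H: "\<And>j. j < m \<Longrightarrow> H j \<in> borel_measurable (F (a j))" "\<And>j \<omega>. j < m \<Longrightarrow> \<bar>H j \<omega>\<bar> \<le> K"
    and v: "\<And>j. j < m \<Longrightarrow> (\<integral>\<omega>. (M (b j) \<omega> - M (a j) \<omega>)\<^sup>2 \<partial>P) \<le> v"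
    and l: "l > 0"
  shows "(\<integral>\<omega>. (\<Sum>j<m. H j \<omega> * (M (b j) \<omega> - M (a j) \<omega>))\<^sup>2 \<partial>P)
      \<le> l * K ^ 3 / 2 * (\<Sum>j<m. \<integral>\<omega>. \<bar>H j \<omega>\<bar> \<partial>P) + real m * (3 * v\<^sup>2 / (2 * l))"
proof -
  have "(\<integral>\<omega>. (H j \<omega>)\<^sup>2 * (M (b j) \<omega> - M (a j) \<omega>)\<^sup>2 \<partial>P)
      \<le> l * K ^ 3 / 2 * (\<integral>\<omega>. \<bar>H j \<omega>\<bar> \<partial>P) + 3 * v\<^sup>2 / (2 * l)" if j: "j < m" for j
  proof -
    define I where "I = (\<lambda>\<omega>. M (b j) \<omega> - M (a j) \<omega>)"
    have K0: "K \<ge> 0" using H(2)[OF j] by (meson abs_ge_zero order_trans)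
    have [measurable]: "H j \<in> borel_measurable P" using measurable_from_subalg[OF subalg H(1)[OF j]] .
    have Hi: "integrable P (\<lambda>\<omega>. \<bar>H j \<omega>\<bar>)"
      by (rule integrable_const_bound[where B = K]) (use H(2)[OF j] in auto)
    have I: "integrable P (\<lambda>\<omega>. I \<omega> ^ 4)" "(\<integral>\<omega>. I \<omega> ^ 4 \<partial>P) = 3 * (\<integral>\<omega>. (I \<omega>)\<^sup>2 \<partial>P)\<^sup>2"
      using centered_gaussian_moment[OF prob_space_axioms gaussian_process_diff[OF gaussian ab(1,2)[OF j]]
        centered_process_diff[OF centered ab(1,2)[OF j]], of 2]
      by (simp_all add: I_def fact_numeral)
    have vI: "(\<integral>\<omega>. (I \<omega>)\<^sup>2 \<partial>P) \<le> v" using v[OF j] by (simp add: I_def)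
    have "(\<integral>\<omega>. (H j \<omega>)\<^sup>2 * (I \<omega>)\<^sup>2 \<partial>P) \<le> (\<integral>\<omega>. l * K ^ 3 / 2 * \<bar>H j \<omega>\<bar> + I \<omega> ^ 4 / (2 * l) \<partial>P)"
    proof (rule integral_mono_AE')
      show "integrable P (\<lambda>\<omega>. l * K ^ 3 / 2 * \<bar>H j \<omega>\<bar> + I \<omega> ^ 4 / (2 * l))" using Hi I by auto
      show "AE \<omega> in P. (H j \<omega>)\<^sup>2 * (I \<omega>)\<^sup>2 \<le> l * K ^ 3 / 2 * \<bar>H j \<omega>\<bar> + I \<omega> ^ 4 / (2 * l)"
      proof (rule AE_I2)
        fix \<omega>
        define x where "x = l * (H j \<omega>)\<^sup>2"
        define y where "y = (I \<omega>)\<^sup>2"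
        have "2 * x * y \<le> x\<^sup>2 + y\<^sup>2" by (rule sum_squares_bound)
        then have "2 * l * ((H j \<omega>)\<^sup>2 * y) \<le> l\<^sup>2 * (H j \<omega>) ^ 4 + y\<^sup>2"
          by (simp add: x_def power_mult_distrib flip: power_mult)
        then have "(H j \<omega>)\<^sup>2 * y \<le> (l\<^sup>2 * (H j \<omega>) ^ 4 + y\<^sup>2) / (2 * l)"
          using l by (simp add: field_simps)
        also have "\<dots> = l / 2 * (H j \<omega>) ^ 4 + y\<^sup>2 / (2 * l)"
          using l by (simp add: field_simps power2_eq_square)
        finally have 1: "(H j \<omega>)\<^sup>2 * y \<le> l / 2 * (H j \<omega>) ^ 4 + y\<^sup>2 / (2 * l)" .
        have "(H j \<omega>) ^ 4 = \<bar>H j \<omega>\<bar> ^ 3 * \<bar>H j \<omega>\<bar>" by (simp add: numeral_eq_Suc abs_mult[symmetric])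
        also have "\<dots> \<le> K ^ 3 * \<bar>H j \<omega>\<bar>" using H(2)[OF j] by (intro mult_right_mono power_mono) auto
        finally have "l / 2 * (H j \<omega>) ^ 4 \<le> l / 2 * (K ^ 3 * \<bar>H j \<omega>\<bar>)" using l by (intro mult_left_mono) auto
        with 1 show "(H j \<omega>)\<^sup>2 * (I \<omega>)\<^sup>2 \<le> l * K ^ 3 / 2 * \<bar>H j \<omega>\<bar> + I \<omega> ^ 4 / (2 * l)"
          by (simp add: y_def flip: power_mult)
      qed
      show "AE \<omega> in P. 0 \<le> l * K ^ 3 / 2 * \<bar>H j \<omega>\<bar> + I \<omega> ^ 4 / (2 * l)" using K0 l by auto
    qed
    also have "\<dots> = l * K ^ 3 / 2 * (\<integral>\<omega>. \<bar>H j \<omega>\<bar> \<partial>P) + 3 * (\<integral>\<omega>. (I \<omega>)\<^sup>2 \<partial>P)\<^sup>2 / (2 * l)"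
      using Hi I by simp
    also have "\<dots> \<le> l * K ^ 3 / 2 * (\<integral>\<omega>. \<bar>H j \<omega>\<bar> \<partial>P) + 3 * v\<^sup>2 / (2 * l)"
      using vI l by (intro add_left_mono divide_right_mono mult_left_mono power_mono) auto
    finally show ?thesis unfolding I_def .
  qed
  then have "(\<Sum>j<m. \<integral>\<omega>. (H j \<omega>)\<^sup>2 * (M (b j) \<omega> - M (a j) \<omega>)\<^sup>2 \<partial>P)
      \<le> (\<Sum>j<m. l * K ^ 3 / 2 * (\<integral>\<omega>. \<bar>H j \<omega>\<bar> \<partial>P) + 3 * v\<^sup>2 / (2 * l))"
    by (intro sum_mono) auto
  moreover have "(\<integral>\<omega>. (\<Sum>j<m. H j \<omega> * (M (b j) \<omega> - M (a j) \<omega>))\<^sup>2 \<partial>P)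
      = (\<Sum>j<m. \<integral>\<omega>. (H j \<omega>)\<^sup>2 * (M (b j) \<omega> - M (a j) \<omega>)\<^sup>2 \<partial>P)"
    using ab H by (rule martingale_transform_L2(2))
  ultimately show ?thesis by (simp add: sum.distrib sum_distrib_left)
qed

text \<open>Orthogonality and the decoupling bound give the refinement increment of level \<open>n\<close> a second moment
  \<open>O(n 2^(- b n / 2))\<close>, hence a first moment \<open>O(n 2^(- b n / 4))\<close>, which is summable.\<close>

lemma AE_convergent_martingale_sums:
  fixes G :: "real \<Rightarrow> 'a \<Rightarrow> real"
  assumes T: "T > 0" and L: "L-lipschitz_on {0..T} (variance_fun P M)"
    and G: "\<And>t. t \<in> {0..T} \<Longrightarrow> G t \<in> borel_measurable (F t)" "\<And>t \<omega>. \<bar>G t \<omega>\<bar> \<le> K"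
    and b: "0 < b" and B: "B \<ge> 0"
    "\<And>n. (\<Sum>j<2 ^ n. \<integral>\<omega>. \<bar>G (dyadic T (Suc n) (Suc (2 * j))) \<omega> - G (dyadic T n j) \<omega>\<bar> \<partial>P)
      \<le> B * (real (Suc n) * 2 powr ((1 - b) * real n))"
  shows "AE \<omega> in P. convergent (\<lambda>n. dyadic_sum T n (\<lambda>u. G u \<omega>) (\<lambda>u. M u \<omega>))"
proof -
  have K0: "K \<ge> 0" using G(2)[of 0 undefined] by linarith
  have L0: "L \<ge> 0" using L by (rule lipschitz_on_nonneg)
  define D where "D = (\<lambda>n \<omega>. dyadic_sum T (Suc n) (\<lambda>u. G u \<omega>) (\<lambda>u. M u \<omega>)
      - dyadic_sum T n (\<lambda>u. G u \<omega>) (\<lambda>u. M u \<omega>))"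
  define A where "A = (2 * K) ^ 3 * B / 2 + 3 * (L * T)\<^sup>2 / 2"
  have A0: "A \<ge> 0" using K0 B by (simp add: A_def)
  have D: "integrable P (\<lambda>\<omega>. (D n \<omega>)\<^sup>2) \<and> D n \<in> borel_measurable P \<and>
      (\<integral>\<omega>. (D n \<omega>)\<^sup>2 \<partial>P) \<le> A * (real (Suc n) * 2 powr (- (b / 2) * real n))" for n
  proof -
    define s where "s = (\<lambda>j. dyadic T (Suc n) (Suc (2 * j)))"
    define t where "t = (\<lambda>j. dyadic T n (Suc j))"
    define H where "H = (\<lambda>j \<omega>. G (s j) \<omega> - G (dyadic T n j) \<omega>)"
    have Deq: "D n = (\<lambda>\<omega>. \<Sum>j<2 ^ n. H j \<omega> * (M (t j) \<omega> - M (s j) \<omega>))"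
      by (simp add: D_def dyadic_sum_refine H_def s_def t_def)
    have t': "t j = dyadic T (Suc n) (Suc (Suc (2 * j)))" for j
      using dyadic_Suc_even[of T n "Suc j"] by (simp add: t_def)
    have mem: "s j \<in> {0..T}" "t j \<in> {0..T}" "dyadic T n j \<in> {0..T}" if "j < 2 ^ n" for j
      unfolding s_def t_def using that T
      by (auto simp del: atLeastAtMost_iff intro!: dyadic_mem)
    have st: "s j \<le> t j" for j unfolding s_def t' using T by (intro dyadic_mono) auto
    have us: "dyadic T n j \<le> s j" for j
      unfolding s_def dyadic_Suc_even[of T n j, symmetric] using T by (intro dyadic_mono) auto
    have ts: "t i \<le> s j" if "i < j" for i j
      unfolding s_def t' using T that by (intro dyadic_mono) auto
    have Hm: "H j \<in> borel_measurable (F (s j))" if "j < 2 ^ n" for j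
      unfolding H_def using mem[OF that] us
      by (intro borel_measurable_diff G(1) measurable_from_subalg[OF filtr G(1)]) auto
    have Hb: "\<bar>H j \<omega>\<bar> \<le> 2 * K" for j \<omega>
      unfolding H_def using G(2)[of "s j" \<omega>] G(2)[of "dyadic T n j" \<omega>] by linarith
    have v: "(\<integral>\<omega>. (M (t j) \<omega> - M (s j) \<omega>)\<^sup>2 \<partial>P) \<le> L * T / 2 ^ n" if j: "j < 2 ^ n" for j
    proof -
      have "(\<integral>\<omega>. (M (t j) \<omega> - M (s j) \<omega>)\<^sup>2 \<partial>P) = variance_fun P M (t j) - variance_fun P M (s j)"
        using mem[OF j] st by (intro increment_variance)
      also have "\<dots> \<le> L * (t j - s j)"
        using lipschitz_onD[OF L mem(2)[OF j] mem(1)[OF j]] st[of j] by (simp add: dist_real_def)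
      also have "t j - s j = T / 2 ^ Suc n" unfolding t' s_def by (rule dyadic_diff)
      also have "L * (T / 2 ^ Suc n) \<le> L * (T / 2 ^ n)"
        using L0 T by (intro mult_left_mono divide_left_mono) auto
      finally show ?thesis by simp
    qed
    have Dm: "D n \<in> borel_measurable P" unfolding Deq
      using mem Hm by (intro borel_measurable_sum borel_measurable_times borel_measurable_diff
        measurable_P measurable_from_subalg[OF subalg Hm]) auto
    have D2: "integrable P (\<lambda>\<omega>. (D n \<omega>)\<^sup>2)" unfolding Deq
      by (rule martingale_transform_L2(1)[where a = s and b = t and K = "2 * K"])
        (use mem st ts Hm Hb in auto)
    (* This weight gives both terms of the decoupling bound the order 2 powr (- b n / 2),
       up to the factor Suc n in the first. *)
    define l where "l = 2 powr (- (1 - b / 2) * real n)"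
    define p where "p = 2 powr (- (b / 2) * real n)"
    have l: "l > 0" by (simp add: l_def)
    have p2: "(2::real) ^ n = 2 powr real n" by (simp add: powr_realpow)
    have l1: "l * 2 powr ((1 - b) * real n) = p"
      unfolding l_def p_def powr_add[symmetric] by (simp add: algebra_simps)
    have l2: "l * 2 ^ n = 1 / p"
      unfolding l_def p_def p2 powr_add[symmetric] powr_minus_divide[symmetric] by (simp add: algebra_simps)
    have p: "p > 0" by (simp add: p_def)
    have "(\<integral>\<omega>. (D n \<omega>)\<^sup>2 \<partial>P) \<le> l * (2 * K) ^ 3 / 2 * (\<Sum>j<2 ^ n. \<integral>\<omega>. \<bar>H j \<omega>\<bar> \<partial>P)
        + real (2 ^ n) * (3 * (L * T / 2 ^ n)\<^sup>2 / (2 * l))" unfolding Deq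
      by (rule martingale_transform_L2_le[where a = s and b = t and K = "2 * K"])
        (use mem st ts Hm Hb v l in auto)
    also have "\<dots> \<le> l * (2 * K) ^ 3 / 2 * (B * (real (Suc n) * 2 powr ((1 - b) * real n)))
        + real (2 ^ n) * (3 * (L * T / 2 ^ n)\<^sup>2 / (2 * l))"
      using B(2)[of n] K0 l by (intro add_right_mono mult_left_mono) (auto simp: H_def s_def)
    also have "l * (2 * K) ^ 3 / 2 * (B * (real (Suc n) * 2 powr ((1 - b) * real n)))
        = (2 * K) ^ 3 * B / 2 * (real (Suc n) * (l * 2 powr ((1 - b) * real n)))" by simp
    also have "real (2 ^ n) * (3 * (L * T / 2 ^ n)\<^sup>2 / (2 * l)) = 3 * (L * T)\<^sup>2 / 2 * (1 / (l * 2 ^ n))"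
      using l by (simp add: power2_eq_square field_simps)
    also have "1 / (l * 2 ^ n) = p" unfolding l2 by simp
    also have "l * 2 powr ((1 - b) * real n) = p" by (rule l1)
    also have "(2 * K) ^ 3 * B / 2 * (real (Suc n) * p) + 3 * (L * T)\<^sup>2 / 2 * p
        \<le> (2 * K) ^ 3 * B / 2 * (real (Suc n) * p) + 3 * (L * T)\<^sup>2 / 2 * (real (Suc n) * p)"
      using p by (intro add_left_mono mult_left_mono) auto
    also have "\<dots> = A * (real (Suc n) * p)" unfolding A_def distrib_right ..
    finally show ?thesis using Dm D2 by (simp add: p_def)
  qed
  have "AE \<omega> in P. summable (\<lambda>n. \<bar>D n \<omega>\<bar>)"
  proof (rule AE_summable_of_expectations)
    show "integrable P (D n)" for n
      by (rule square_integrable_imp_integrable) (use D[of n] in auto)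
    show "summable (\<lambda>n. (A + 1) * (real (Suc n) * 2 powr (- (b / 4) * real n)))"
      using summable_Suc_powr[of "b / 4"] b by (intro summable_mult) auto
    show "(\<integral>\<omega>. \<bar>D n \<omega>\<bar> \<partial>P) \<le> (A + 1) * (real (Suc n) * 2 powr (- (b / 4) * real n))" for n
    proof -
      define q where "q = 2 powr (- (b / 4) * real n)"
      have q: "q > 0" by (simp add: q_def)
      have qq: "2 powr (- (b / 2) * real n) = q * q"
        unfolding q_def powr_add[symmetric] by (simp add: algebra_simps)
      have "(\<integral>\<omega>. \<bar>D n \<omega>\<bar> \<partial>P) \<le> (\<integral>\<omega>. (D n \<omega>)\<^sup>2 / (2 * q) + q / 2 \<partial>P)"
      proof (rule integral_mono_AE')
        show "AE \<omega> in P. \<bar>D n \<omega>\<bar> \<le> (D n \<omega>)\<^sup>2 / (2 * q) + q / 2"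
        proof (rule AE_I2)
          fix \<omega>
          (* The first moment via the second: q is the order of the root mean square
             of D n, up to a power of n. *)
          have "2 * \<bar>D n \<omega>\<bar> * q \<le> \<bar>D n \<omega>\<bar>\<^sup>2 + q\<^sup>2" by (rule sum_squares_bound)
          then show "\<bar>D n \<omega>\<bar> \<le> (D n \<omega>)\<^sup>2 / (2 * q) + q / 2"
            using q by (simp add: field_simps power2_eq_square)
        qed
        show "AE \<omega> in P. 0 \<le> (D n \<omega>)\<^sup>2 / (2 * q) + q / 2" using q by simp
      qed (use D[of n] in auto)
      also have "\<dots> = (\<integral>\<omega>. (D n \<omega>)\<^sup>2 \<partial>P) / (2 * q) + q / 2"
        using D[of n] by (simp add: prob_space)
      also have "\<dots> \<le> A * (real (Suc n) * (q * q)) / (2 * q) + q / 2"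
        using D[of n] q unfolding qq by (intro add_right_mono divide_right_mono) auto
      also have "\<dots> = A / 2 * (real (Suc n) * q) + 1 / 2 * (1 * q)" using q by (simp add: field_simps)
      also have "\<dots> \<le> A * (real (Suc n) * q) + 1 * (real (Suc n) * q)"
        using A0 q by (intro add_mono mult_mono) auto
      finally show ?thesis unfolding q_def[symmetric] by (simp only: distrib_right)
    qed
  qed
  then show ?thesis
  proof eventually_elim
    case (elim \<omega>)
    then show ?case unfolding D_def by (rule convergent_if_summable_increments)
  qed
qed

lemma AE_convergent_foellmer_sums:
  fixes X Y :: "real \<Rightarrow> 'a \<Rightarrow> real" and g :: "real \<Rightarrow> real" and \<tau> :: "'a \<Rightarrow> real"
  assumes T: "T > 0" and L: "L-lipschitz_on {0..T} (variance_fun P M)"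
    and M: "continuous_process P T M"
    and X: "hoelder_process P T \<alpha> X" "\<alpha> > 1 / 2"
    and Y: "gaussian_process P T Y" "centered_process P T Y" "adapted_process F T Y"
    and incr: "\<And>s t. s \<in> {0..T} \<Longrightarrow> t \<in> {0..T} \<Longrightarrow> (\<integral>\<omega>. (Y t \<omega> - Y s \<omega>)\<^sup>2 \<partial>P) \<le> C * \<bar>t - s\<bar>"
    and c: "c > 0" "\<And>s. s \<in> {0..T} \<Longrightarrow> (\<integral>\<omega>. (Y s \<omega>)\<^sup>2 \<partial>P) \<ge> c * s\<^sup>2"
    and g: "mono g" "\<And>x. \<bar>g x\<bar> \<le> K" "\<And>x. g x = g (max (-N) (min N x))" and N: "N \<ge> 0"
    and \<tau>: "stopping_time F \<tau>"
  shows "AE \<omega> in P.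
    convergent (\<lambda>n. foellmer_sum (2 ^ n) (dyadic T n) (\<lambda>u. g (Y u \<omega>)) (\<lambda>u. M u \<omega>) (\<tau> \<omega>)) \<and>
    convergent (\<lambda>n. foellmer_sum (2 ^ n) (dyadic T n) (\<lambda>u. g (Y u \<omega>)) (\<lambda>u. X u \<omega>) (\<tau> \<omega>))"
proof -
  (* Half way between 1 - alpha and 1/2, but kept positive when alpha is large. *)
  define b where "b = max (1 / 4) ((3 / 2 - \<alpha>) / 2)"
  have b: "0 < b" "b < 1 / 2" "\<alpha> > 1 - b" using X(2) by (auto simp: b_def max_def field_simps)
  define G where "G = (\<lambda>t \<omega>. if t < \<tau> \<omega> then g (Y t \<omega>) else 0)"
  have \<tau>m: "\<tau> \<in> borel_measurable P"
    using \<tau> by (rule measurable_stopping_time) (use subalg in \<open>auto simp: subalgebra_def\<close>)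
  obtain B where B: "B \<ge> 0"
    "\<And>n. (\<Sum>j<2 ^ n. \<integral>\<omega>. \<bar>G (dyadic T (Suc n) (Suc (2 * j))) \<omega> - G (dyadic T n j) \<omega>\<bar> \<partial>P)
      \<le> B * (real (Suc n) * 2 powr ((1 - b) * real n))"
    unfolding G_def using stopped_increment_sum_le[OF prob_space_axioms T Y(1,2) incr c g N b(1,2) \<tau>m] by blast
  have gm[measurable]: "g \<in> borel_measurable borel" by (rule borel_measurable_mono[OF g(1)])
  have GF: "G t \<in> borel_measurable (F t)" if "t \<in> {0..T}" for t
  proof -
    have [measurable]: "Y t \<in> borel_measurable (F t)" using Y(3) that by (simp add: adapted_process_def)
    have [measurable]: "Measurable.pred (F t) (\<lambda>\<omega>. t < \<tau> \<omega>)" by (rule stopping_timeD2[OF \<tau>])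
    show ?thesis unfolding G_def by measurable
  qed
  have Gb: "\<bar>G t \<omega>\<bar> \<le> K" for t \<omega> using g(2)[of "Y t \<omega>"] by (auto simp: G_def)
  have "AE \<omega> in P. convergent (\<lambda>n. dyadic_sum T n (\<lambda>u. G u \<omega>) (\<lambda>u. M u \<omega>))"
    by (rule AE_convergent_martingale_sums[OF T L GF Gb b(1) B])
  moreover have "AE \<omega> in P. convergent (\<lambda>n. dyadic_sum T n (\<lambda>u. G u \<omega>) (\<lambda>u. X u \<omega>))"
    by (rule AE_convergent_hoelder_sums[OF prob_space_axioms T X(1) b(3) measurable_from_subalg[OF subalg GF] Gb B(2)])
  moreover have "AE \<omega> in P. continuous_on {0..T} (\<lambda>t. M t \<omega>)" using M by (simp add: continuous_process_def)
  moreover obtain D where "AE \<omega> in P. \<forall>s\<in>{0..T}. \<forall>t\<in>{0..T}. \<bar>X t \<omega> - X s \<omega>\<bar> \<le> D \<omega> * \<bar>t - s\<bar> powr \<alpha>"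
    using X(1) by (auto simp: hoelder_process_def)
  ultimately show ?thesis
  proof eventually_elim
    case (elim \<omega>)
    have "continuous_on {0..T} (\<lambda>t. X t \<omega>)"
      by (rule continuous_on_hoelder_bound[where C = "D \<omega>" and \<alpha> = \<alpha>]) (use elim(4) X(2) in auto)
    with elim show ?case unfolding G_def
      by (intro conjI convergent_foellmer_dyadic[OF T _ g(2)])
  qed
qed

end

section \<open>Left derivatives of convex functions\<close>

text \<open>Slopes of a convex function increase in both end points. Monotonicity in the free end point gives
  the existence of the one-sided limit as a supremum, and comparing slopes at two base points shows
  that the limit is monotone in the base point.\<close>

lemma convex_left_deriv:
  fixes g :: "real \<Rightarrow> real"
  assumes "convex_on UNIV g"
  shows "(g has_real_derivative left_deriv g x) (at_left x)" "mono (left_deriv g)"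
proof -
  define q where "q = (\<lambda>x y. (g y - g x) / (y - x))"
  define D where "D = (\<lambda>x. Sup (q x ` {..<x}))"
  have q_mono: "q x a \<le> q x b" if "a \<le> b" "b < x" for a b x
  proof (cases "a = b")
    case False
    then have ab: "a < b" using that by simp
    have "(g a - g x) / (a - x) \<le> (g b - g x) / (b - x)"
      by (rule convex_on_slope_le(2)[OF assms]) (use ab that in auto)
    then show ?thesis by (simp add: q_def)
  qed simp
  have q_slope: "q x a \<le> q y x" if "a < x" "x < y" for a x y
  proof -
    have "(g a - g x) / (a - x) \<le> (g a - g y) / (a - y)"
      by (rule convex_on_slope_le(1)[OF assms]) (use that in auto)
    also have "\<dots> \<le> (g x - g y) / (x - y)"
      by (rule convex_on_slope_le(2)[OF assms]) (use that in auto)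
    finally show ?thesis by (simp add: q_def)
  qed
  have der: "(g has_real_derivative D x) (at_left x)" for x
  proof -
    have "(q x \<longlongrightarrow> Sup (q x ` ({..<x} \<inter> UNIV))) (at x within ({..<x} \<inter> UNIV))"
    proof (rule Lim_left_bound)
      fix b assume "b < x"
      then show "q x b \<le> q (x + 1) x" by (intro q_slope) auto
    qed (use q_mono in auto)
    then show ?thesis by (simp add: has_field_derivative_iff q_def D_def)
  qed
  have D: "left_deriv g x = D x" for x
    unfolding left_deriv_def using der[of x]
    by (intro vector_derivative_within) (auto simp: has_real_derivative_iff_has_vector_derivative)
  show "(g has_real_derivative left_deriv g x) (at_left x)" using der D by simp
  show "mono (left_deriv g)"
  proof (rule monoI)
    fix x y :: real assume "x \<le> y"
    show "left_deriv g x \<le> left_deriv g y"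
    proof (cases "x = y")
      case False
      then have xy: "x < y" using \<open>x \<le> y\<close> by simp
      have "D x \<le> q y x" unfolding D_def
        by (rule cSUP_least) (use q_slope xy lt_ex in auto)
      also have "\<dots> \<le> D y" unfolding D_def
      proof (rule cSUP_upper)
        show "bdd_above (q y ` {..<y})"
          by (rule bdd_aboveI[where M = "q (y + 1) y"]) (use q_slope in auto)
      qed (use xy in simp)
      finally show ?thesis unfolding D .
    qed simp
  qed
qed

lemma left_deriv_sum_convex:
  fixes n :: nat and g :: "nat \<Rightarrow> real \<Rightarrow> real"
  assumes "\<And>i. i < n \<Longrightarrow> convex_on UNIV (g i)"
  shows "left_deriv (\<lambda>x. \<Sum>i<n. a i * g i x) x = (\<Sum>i<n. a i * left_deriv (g i) x)"
proof -
  have "((\<lambda>x. \<Sum>i<n. a i * g i x) has_real_derivative (\<Sum>i<n. a i * left_deriv (g i) x)) (at_left x)"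
    by (intro DERIV_sum DERIV_cmult convex_left_deriv(1) assms) auto
  then show ?thesis unfolding left_deriv_def[of "\<lambda>x. \<Sum>i<n. a i * g i x"]
    by (intro vector_derivative_within) (auto simp: has_real_derivative_iff_has_vector_derivative)
qed

section \<open>Existence of the integral\<close>

lemma subalgebra_natural_filtration:
  assumes "gaussian_process P T M"
  shows "subalgebra P (natural_filtration P T M t)"
proof -
  let ?G = "{M s -` B \<inter> space P | s B. 0 \<le> s \<and> s \<le> t \<and> s \<le> T \<and> B \<in> sets borel}"
  have "?G \<subseteq> sets P"
    using gaussian_process_measurable[OF assms] by (auto intro: measurable_sets)
  then have "sigma_sets (space P) ?G \<subseteq> sets P" by (rule sets.sigma_sets_subset)
  moreover have "?G \<subseteq> Pow (space P)" by auto
  ultimately show ?thesis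
    by (simp add: subalgebra_def natural_filtration_def space_measure_of sets_measure_of)
qed

lemma natural_filtration_mono:
  assumes "s \<le> t"
  shows "subalgebra (natural_filtration P T M t) (natural_filtration P T M s)"
proof -
  let ?G = "\<lambda>t. {M s -` B \<inter> space P | s B. 0 \<le> s \<and> s \<le> t \<and> s \<le> T \<and> B \<in> sets borel}"
  have G: "?G t \<subseteq> Pow (space P)" for t by auto
  have "?G s \<subseteq> ?G t" using assms by (auto intro: order_trans)
  then have "sigma_sets (space P) (?G s) \<subseteq> sigma_sets (space P) (?G t)" by (rule sigma_sets_mono')
  then show ?thesis using G[of s] G[of t]
    by (simp add: subalgebra_def natural_filtration_def space_measure_of sets_measure_of)
qed

theorem theorem3p4:
  fixes P :: "'a measure" and T \<alpha> :: real
    and M X Y :: "real \<Rightarrow> 'a \<Rightarrow> real"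
    and R :: "real \<Rightarrow> real \<Rightarrow> real" and V :: "real \<Rightarrow> real"
    and FM :: "real \<Rightarrow> 'a measure"
    and f :: "real \<Rightarrow> real" and \<tau> :: "'a \<Rightarrow> real"
  assumes "prob_space P" and "T > 0"
    and FM: "FM = natural_filtration P T M"
    and M_gaussian: "gaussian_process P T M" "centered_process P T M"
    and M_martingale: "martingale_process P FM T M"
    and M_variance: "\<exists>L. L-lipschitz_on {0..T} (variance_fun P M)"
    and X_gaussian: "gaussian_process P T X"
    and X_hoelder: "\<alpha> > 1 / 2" "hoelder_process P T \<alpha> X"
    and Y: "Y = (\<lambda>t \<omega>. M t \<omega> + X t \<omega>)"
    and Y_gaussian: "gaussian_process P T Y" "centered_process P T Y" "continuous_process P T Y"
    and R: "R = second_moment_fun P Y"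
    and V: "V = (\<lambda>t. R t t)"
    and a: "\<forall>s\<in>{0<..T}. \<forall>t\<in>{0<..T}. R s t > 0"
    and b: "\<exists>c>0. \<exists>\<delta>>0. \<forall>s\<in>{0..T}. s \<le> \<delta> \<longrightarrow> V s \<ge> c * s\<^sup>2"
    and c: "\<exists>\<delta>>0. (SUP t\<in>{t. 0 < t \<and> t < 2 * \<delta> \<and> t \<le> T}.
                     SUP s\<in>{t / 2..t}. ereal (R s s / R t s)) < \<infinity>"
    and d: "adapted_process FM T Y"
    and f: "lin_comb_convex f"
    and \<tau>: "stopping_time FM \<tau>" "\<forall>\<omega>\<in>space P. 0 \<le> \<tau> \<omega> \<and> \<tau> \<omega> \<le> T"
  shows "\<exists>k p. partition_seq T k p \<and>
           foellmer_integral_exists P k p (\<lambda>u \<omega>. left_deriv f (Y u \<omega>)) Y \<tau> \<and>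
           foellmer_integral_exists P k p (\<lambda>u \<omega>. left_deriv f (Y u \<omega>)) M \<tau> \<and>
           foellmer_integral_exists P k p (\<lambda>u \<omega>. left_deriv f (Y u \<omega>)) X \<tau> \<and>
           (AE \<omega> in P.
              foellmer_integral k p (\<lambda>u \<omega>. left_deriv f (Y u \<omega>)) Y \<tau> \<omega> =
              foellmer_integral k p (\<lambda>u \<omega>. left_deriv f (Y u \<omega>)) M \<tau> \<omega> +
              foellmer_integral k p (\<lambda>u \<omega>. left_deriv f (Y u \<omega>)) X \<tau> \<omega>)"
proof -
  interpret prob_space P by fact
  have T: "T > 0" by fact
  interpret gaussian_martingale P FM T M
    by unfold_locales
      (simp_all add: FM subalgebra_natural_filtration natural_filtration_mono M_gaussian
        M_martingale[unfolded FM])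
  obtain L where L: "L-lipschitz_on {0..T} (variance_fun P M)" using M_variance by blast
  have Xc: "centered_process P T X"
  proof -
    have "X t = (\<lambda>\<omega>. Y t \<omega> - M t \<omega>)" for t by (simp add: Y)
    then show ?thesis using M_gaussian(2) Y_gaussian(2) by (simp add: centered_process_def)
  qed
  obtain C where C: "C \<ge> 0" "\<And>s t. s \<in> {0..T} \<Longrightarrow> t \<in> {0..T} \<Longrightarrow>
      (\<integral>\<omega>. (X t \<omega> - X s \<omega>)\<^sup>2 \<partial>P) \<le> C * \<bar>t - s\<bar> powr (2 * \<alpha>)"
    using hoelder_gaussian_increment_variance[OF prob_space_axioms X_gaussian Xc X_hoelder(2)] by blast
  define C' where "C' = 2 * L + 2 * (C * T powr (2 * \<alpha> - 1))"
  have incr: "(\<integral>\<omega>. (Y t \<omega> - Y s \<omega>)\<^sup>2 \<partial>P) \<le> C' * \<bar>t - s\<bar>" if st: "s \<in> {0..T}" "t \<in> {0..T}" for s t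
  proof -
    have Mv: "(\<integral>\<omega>. (M t \<omega> - M s \<omega>)\<^sup>2 \<partial>P) \<le> L * \<bar>t - s\<bar>" if "s \<in> {0..T}" "t \<in> {0..T}" "s \<le> t" for s t
      using increment_variance[OF that] lipschitz_onD[OF L that(2,1)] by (simp add: dist_real_def)
    have "(\<integral>\<omega>. (M t \<omega> - M s \<omega>)\<^sup>2 \<partial>P) \<le> L * \<bar>t - s\<bar>"
      using Mv[of s t] Mv[of t s] st by (cases "s \<le> t") (auto simp: power2_commute abs_minus_commute)
    moreover have "\<bar>t - s\<bar> powr (2 * \<alpha>) \<le> T powr (2 * \<alpha> - 1) * \<bar>t - s\<bar>"
    proof (cases "s = t")
      case False
      have "\<bar>t - s\<bar> powr (2 * \<alpha>) = \<bar>t - s\<bar> powr (2 * \<alpha> - 1) * \<bar>t - s\<bar>"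
        using False powr_add[of "\<bar>t - s\<bar>" "2 * \<alpha> - 1" 1] by simp
      also have "\<dots> \<le> T powr (2 * \<alpha> - 1) * \<bar>t - s\<bar>"
        using st X_hoelder(1) by (intro mult_right_mono powr_mono2) auto
      finally show ?thesis .
    qed simp
    then have "C * \<bar>t - s\<bar> powr (2 * \<alpha>) \<le> C * T powr (2 * \<alpha> - 1) * \<bar>t - s\<bar>"
      using C(1) by (simp add: mult_left_mono mult.assoc)
    moreover have "(\<integral>\<omega>. (Y t \<omega> - Y s \<omega>)\<^sup>2 \<partial>P)
        \<le> 2 * (\<integral>\<omega>. (M t \<omega> - M s \<omega>)\<^sup>2 \<partial>P) + 2 * (\<integral>\<omega>. (X t \<omega> - X s \<omega>)\<^sup>2 \<partial>P)"
    proof -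
      have i: "integrable P (\<lambda>\<omega>. (M t \<omega> - M s \<omega>)\<^sup>2)" "integrable P (\<lambda>\<omega>. (X t \<omega> - X s \<omega>)\<^sup>2)"
        using increment_square_integrable[OF st]
          centered_gaussian_moment(1)[OF prob_space_axioms gaussian_process_diff[OF X_gaussian st]
            centered_process_diff[OF Xc st], of 1] by simp_all
      have "(\<integral>\<omega>. (Y t \<omega> - Y s \<omega>)\<^sup>2 \<partial>P)
          \<le> (\<integral>\<omega>. 2 * (M t \<omega> - M s \<omega>)\<^sup>2 + 2 * (X t \<omega> - X s \<omega>)\<^sup>2 \<partial>P)"
      proof (rule integral_mono_AE')
        have "(x + y)\<^sup>2 \<le> 2 * x\<^sup>2 + 2 * y\<^sup>2" for x y :: real
          using sum_squares_bound[of x y] by (simp add: power2_sum)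
        then show "AE \<omega> in P. (Y t \<omega> - Y s \<omega>)\<^sup>2 \<le> 2 * (M t \<omega> - M s \<omega>)\<^sup>2 + 2 * (X t \<omega> - X s \<omega>)\<^sup>2"
          unfolding Y by (intro AE_I2) (metis add_diff_add)
      qed (use i in auto)
      then show ?thesis using i by simp
    qed
    ultimately show ?thesis using C(2)[OF st] by (simp add: C'_def distrib_right)
  qed
  have Ysq: "integrable P (\<lambda>\<omega>. (Y s \<omega>)\<^sup>2)" if "s \<in> {0..T}" for s
    using centered_gaussian_moment(1)[OF prob_space_axioms gaussian_process_rv[OF Y_gaussian(1) that], of 1]
      Y_gaussian(2) that by (simp add: centered_process_def)
  have Veq: "V = (\<lambda>s. \<integral>\<omega>. (Y s \<omega>)\<^sup>2 \<partial>P)"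
    by (simp add: V R second_moment_fun_def power2_eq_square)
  obtain c where c: "c > 0" "\<And>s. s \<in> {0..T} \<Longrightarrow> (\<integral>\<omega>. (Y s \<omega>)\<^sup>2 \<partial>P) \<ge> c * s\<^sup>2"
  proof -
    obtain c \<delta> where c: "c > 0" "\<delta> > 0" "\<And>s. s \<in> {0..T} \<Longrightarrow> s \<le> \<delta> \<Longrightarrow> V s \<ge> c * s\<^sup>2" using b by blast
    have pos: "V s > 0" if "s \<in> {0<..T}" for s using a that by (simp add: V)
    have cmp: "V s \<le> 2 * V t + 2 * C' * \<bar>s - t\<bar>" if st: "s \<in> {0..T}" "t \<in> {0..T}" for s t
    proof -
      have i: "integrable P (\<lambda>\<omega>. (Y s \<omega> - Y t \<omega>)\<^sup>2)"
        using centered_gaussian_moment(1)[OF prob_space_axioms gaussian_process_diff[OF Y_gaussian(1) st(2,1)]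
            centered_process_diff[OF Y_gaussian(2) st(2,1)], of 1] by simp
      have "V s \<le> (\<integral>\<omega>. 2 * (Y t \<omega>)\<^sup>2 + 2 * (Y s \<omega> - Y t \<omega>)\<^sup>2 \<partial>P)"
        unfolding Veq
      proof (rule integral_mono_AE')
        have "x\<^sup>2 \<le> 2 * y\<^sup>2 + 2 * (x - y)\<^sup>2" for x y :: real
          using zero_le_power2[of "x - 2 * y"] by (simp add: power2_eq_square algebra_simps)
        then show "AE \<omega> in P. (Y s \<omega>)\<^sup>2 \<le> 2 * (Y t \<omega>)\<^sup>2 + 2 * (Y s \<omega> - Y t \<omega>)\<^sup>2" by simp
      qed (use i Ysq[OF st(2)] in auto)
      also have "\<dots> = 2 * V t + 2 * (\<integral>\<omega>. (Y s \<omega> - Y t \<omega>)\<^sup>2 \<partial>P)" using i Ysq[OF st(2)] by (simp add: Veq)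
      finally show ?thesis using incr[OF st(2,1)] by simp
    qed
    from quadratic_lower_bound[OF c pos cmp] that show thesis unfolding Veq by blast
  qed
  have Mcont: "continuous_process P T M"
  proof -
    obtain D where "AE \<omega> in P. \<forall>s\<in>{0..T}. \<forall>t\<in>{0..T}. \<bar>X t \<omega> - X s \<omega>\<bar> \<le> D \<omega> * \<bar>t - s\<bar> powr \<alpha>"
      using X_hoelder(2) by (auto simp: hoelder_process_def)
    moreover have "AE \<omega> in P. continuous_on {0..T} (\<lambda>t. Y t \<omega>)"
      using Y_gaussian(3) by (simp add: continuous_process_def)
    ultimately show ?thesis unfolding continuous_process_def
    proof eventually_elim
      case (elim \<omega>)
      have "continuous_on {0..T} (\<lambda>t. X t \<omega>)"
        by (rule continuous_on_hoelder_bound[where C = "D \<omega>" and \<alpha> = \<alpha>]) (use elim(1) X_hoelder(1) in auto)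
      from continuous_on_diff[OF elim(2) this] show ?case by (simp add: Y)
    qed
  qed
  obtain n :: nat and a g where g: "\<And>i. i < n \<Longrightarrow> convex_on UNIV (g i)" and feq: "f = (\<lambda>x. \<Sum>i<n. a i * g i x)"
    using f by (auto simp: lin_comb_convex_def)
  (* Freezing the left derivative outside [-N, N] makes it bounded. The exceptional null set
     may depend on N, so N ranges over the natural numbers; on a given path some N exceeds
     the maximum of Y and the truncation disappears. *)
  define h where "h = (\<lambda>i (N::nat) x. left_deriv (g i) (max (- real N) (min (real N) x)))"
  define S where "S = (\<lambda>h z n \<omega>. foellmer_sum (2 ^ n) (dyadic T n) (\<lambda>u. h (Y u \<omega>)) (\<lambda>u. z u \<omega>) (\<tau> \<omega>))"
  have conv: "AE \<omega> in P. i < n \<longrightarrow> convergent (\<lambda>m. S (h i N) M m \<omega>) \<and> convergent (\<lambda>m. S (h i N) X m \<omega>)" for i N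
  proof (cases "i < n")
    case True
    have mono: "mono (left_deriv (g i))" by (rule convex_left_deriv(2)[OF g[OF True]])
    have "AE \<omega> in P. convergent (\<lambda>m. S (h i N) M m \<omega>) \<and> convergent (\<lambda>m. S (h i N) X m \<omega>)"
      unfolding S_def
    proof (rule AE_convergent_foellmer_sums[OF T L Mcont X_hoelder(2,1) Y_gaussian(1,2) d incr c _ _ _ _ \<tau>(1)])
      show "mono (h i N)" unfolding h_def
        by (intro monoI monoD[OF mono] max.mono min.mono) auto
      show "\<bar>h i N x\<bar> \<le> \<bar>left_deriv (g i) (- real N)\<bar> + \<bar>left_deriv (g i) (real N)\<bar>" for x
      proof -
        have "left_deriv (g i) (- real N) \<le> h i N x" "h i N x \<le> left_deriv (g i) (real N)"
          unfolding h_def by (intro monoD[OF mono]; simp)+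
        then show ?thesis by linarith
      qed
      show "h i N x = h i N (max (- real N) (min (real N) x))" for x by (simp add: h_def)
    qed auto
    then show ?thesis by simp
  qed simp
  have "AE \<omega> in P. \<forall>i N. i < n \<longrightarrow> convergent (\<lambda>m. S (h i N) M m \<omega>) \<and> convergent (\<lambda>m. S (h i N) X m \<omega>)"
    using conv by (simp add: AE_all_countable)
  moreover have "AE \<omega> in P. continuous_on {0..T} (\<lambda>t. Y t \<omega>)"
    using Y_gaussian(3) by (simp add: continuous_process_def)
  ultimately have main: "AE \<omega> in P. convergent (\<lambda>m. S (left_deriv f) M m \<omega>) \<and> convergent (\<lambda>m. S (left_deriv f) X m \<omega>)"
  proof eventually_elim
    case (elim \<omega>)
    have "compact ((\<lambda>t. Y t \<omega>) ` {0..T})" using elim(2) by (intro compact_continuous_image) auto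
    then obtain r where r: "\<And>u. u \<in> {0..T} \<Longrightarrow> \<bar>Y u \<omega>\<bar> \<le> r"
      using compact_imp_bounded bounded_iff by (metis imageI real_norm_def)
    obtain N :: nat where N: "r \<le> real N" using real_arch_simple by blast
    have hY: "left_deriv f (Y u \<omega>) = (\<Sum>i<n. a i * h i N (Y u \<omega>))" if "u \<in> {0..T}" for u
    proof -
      have "max (- real N) (min (real N) (Y u \<omega>)) = Y u \<omega>" using r[OF that] N by auto
      then show ?thesis using g by (simp add: feq left_deriv_sum_convex h_def)
    qed
    have S: "S (left_deriv f) z m \<omega> = (\<Sum>i<n. a i * S (h i N) z m \<omega>)" for z m
    proof -
      have "S (left_deriv f) z m \<omega> = (\<Sum>j | j < 2 ^ m \<and> dyadic T m (Suc j) \<le> \<tau> \<omega>.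
          (\<Sum>i<n. a i * h i N (Y (dyadic T m j) \<omega>)) * (z (dyadic T m (Suc j)) \<omega> - z (dyadic T m j) \<omega>))"
        unfolding S_def foellmer_sum_def
        using T by (intro sum.cong refl) (simp add: hY dyadic_mem less_imp_le del: atLeastAtMost_iff)
      also have "\<dots> = (\<Sum>i<n. a i * S (h i N) z m \<omega>)"
        unfolding S_def foellmer_sum_def sum_distrib_left sum_distrib_right
        by (subst sum.swap) (simp add: mult.assoc)
      finally show ?thesis .
    qed
    have cs: "convergent (\<lambda>m. \<Sum>i<n. a i * s i m)" if "\<And>i. i < n \<Longrightarrow> convergent (s i)" for s :: "nat \<Rightarrow> nat \<Rightarrow> real"
    proof (rule convergentI)
      show "(\<lambda>m. \<Sum>i<n. a i * s i m) \<longlonglongrightarrow> (\<Sum>i<n. a i * lim (s i))"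
        using that by (intro tendsto_sum tendsto_mult tendsto_const) (auto simp: convergent_LIMSEQ_iff)
    qed
    show ?case unfolding S using elim(1) by (auto intro!: cs)
  qed
  have SY: "S (left_deriv f) Y m \<omega> = S (left_deriv f) M m \<omega> + S (left_deriv f) X m \<omega>" for m \<omega>
    unfolding S_def foellmer_sum_def Y sum.distrib[symmetric]
    by (intro sum.cong refl) (simp add: algebra_simps)
  show ?thesis
  proof (intro exI[of _ "\<lambda>n. 2 ^ n"] exI[of _ "dyadic T"] conjI)
    show "partition_seq T (\<lambda>n. 2 ^ n) (dyadic T)" by (rule partition_seq_dyadic[OF T])
    show "foellmer_integral_exists P (\<lambda>n. 2 ^ n) (dyadic T) (\<lambda>u \<omega>. left_deriv f (Y u \<omega>)) M \<tau>"
      "foellmer_integral_exists P (\<lambda>n. 2 ^ n) (dyadic T) (\<lambda>u \<omega>. left_deriv f (Y u \<omega>)) X \<tau>"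
      using main by (simp_all add: foellmer_integral_exists_def S_def)
    show "foellmer_integral_exists P (\<lambda>n. 2 ^ n) (dyadic T) (\<lambda>u \<omega>. left_deriv f (Y u \<omega>)) Y \<tau>"
    proof -
      have "AE \<omega> in P. convergent (\<lambda>m. S (left_deriv f) Y m \<omega>)"
        using main by eventually_elim (simp add: SY convergent_add)
      then show ?thesis by (simp add: foellmer_integral_exists_def S_def)
    qed
    have "AE \<omega> in P. lim (\<lambda>m. S (left_deriv f) Y m \<omega>)
        = lim (\<lambda>m. S (left_deriv f) M m \<omega>) + lim (\<lambda>m. S (left_deriv f) X m \<omega>)"
      using main
    proof eventually_elim
      case (elim \<omega>)
      then show ?case unfolding SY by (intro limI tendsto_add) (auto simp: convergent_LIMSEQ_iff)
    qed
    then show "AE \<omega> in P.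
        foellmer_integral (\<lambda>n. 2 ^ n) (dyadic T) (\<lambda>u \<omega>. left_deriv f (Y u \<omega>)) Y \<tau> \<omega> =
        foellmer_integral (\<lambda>n. 2 ^ n) (dyadic T) (\<lambda>u \<omega>. left_deriv f (Y u \<omega>)) M \<tau> \<omega> +
        foellmer_integral (\<lambda>n. 2 ^ n) (dyadic T) (\<lambda>u \<omega>. left_deriv f (Y u \<omega>)) X \<tau> \<omega>"
      by (simp add: foellmer_integral_def S_def)
  qed
qed

end
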